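(* For each $d\ge 4$, there is a simplicial $d$-polytope $P$ whose graph $G(P)$ has minimum degree at least $(d^2+d)/2$ and has a nontrivial minimum edge cut with exactly $(d^2+d)/2$ edges.
   Context: A (convex) polytope is the convex hull of a finite set of points in a Euclidean space; a $d$-polytope is a polytope of dimension $d$. A facet of a $d$-polytope is a face of dimension $d-1$. A polytope is simplicial if all its facets are (combinatorially isomorphic to) simplices. The graph $G(P)$ of a polytope $P$ is the finite simple graph whose vertices and edges are the vertices ($0$-dimensional faces) and edges ($1$-dimensional faces) of $P$. For a connected graph $G$ with vertex set $V(G)$, an edge cut is a set of edges of the form $E(X,V(G)\setminus X)$ for some nonempty proper subset $X\subset V(G)$, where $E(X,V(G)\setminus X)$ is the set of all edges with one end in $X$ and the other in $V(G)\setminus X$. A minimum edge cut of $G$ is an edge cut of smallest cardinality among all edge cuts of $G$. An edge cut is trivial if it is exactly the set of all edges incident with a single vertex of $G$; otherwise it is nontrivial. *)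

theory Defs
  imports "HOL-Analysis.Analysis"
begin

definition combinatorially_isomorphic ::
    "'a::euclidean_space set \<Rightarrow> 'b::euclidean_space set \<Rightarrow> bool" where
  "combinatorially_isomorphic P Q \<longleftrightarrow>
     (\<exists>\<phi>. bij_betw \<phi> {F. F face_of P} {G. G face_of Q} \<and>
          (\<forall>F F'. F face_of P \<longrightarrow> F' face_of P \<longrightarrow> (F \<subseteq> F' \<longleftrightarrow> \<phi> F \<subseteq> \<phi> F')))"

text \<open>A combinatorial isomorphism preserves the dimension of a polytope, so it is no restriction
  to look for the simplex in the ambient space of the facet.\<close>

definition simplicial_polytope :: "'a::euclidean_space set \<Rightarrow> bool" where
  "simplicial_polytope P \<longleftrightarrow> polytope P \<and>
     (\<forall>F. F facet_of P \<longrightarrow>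
        (\<exists>n. \<exists>S::'a set. n simplex S \<and> combinatorially_isomorphic F S))"

text \<open>A finite simple graph is a pair of a vertex set and a set of two-element sets of vertices.\<close>

type_synonym 'v sgraph = "'v set \<times> 'v set set"

abbreviation verts_of :: "'v sgraph \<Rightarrow> 'v set" where "verts_of \<equiv> fst"
abbreviation edges_of :: "'v sgraph \<Rightarrow> 'v set set" where "edges_of \<equiv> snd"

text \<open>Every one-dimensional face of a polytope is a segment; it is represented by its pair of
  end points.\<close>

definition polytope_graph :: "'a::euclidean_space set \<Rightarrow> 'a sgraph" where
  "polytope_graph P =
     ({v. v extreme_point_of P}, {{u, v} |u v. closed_segment u v edge_of P})"

definition incident_edges :: "'v sgraph \<Rightarrow> 'v \<Rightarrow> 'v set set" where
  "incident_edges G v = {e \<in> edges_of G. v \<in> e}"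

definition min_degree :: "'v sgraph \<Rightarrow> nat" where
  "min_degree G = Min ((\<lambda>v. card (incident_edges G v)) ` verts_of G)"

definition edges_between :: "'v sgraph \<Rightarrow> 'v set \<Rightarrow> 'v set \<Rightarrow> 'v set set" where
  "edges_between G X Y = {e \<in> edges_of G. \<exists>x\<in>X. \<exists>y\<in>Y. e = {x, y}}"

definition edge_cut :: "'v sgraph \<Rightarrow> 'v set set \<Rightarrow> bool" where
  "edge_cut G C \<longleftrightarrow>
     (\<exists>X. X \<noteq> {} \<and> X \<subset> verts_of G \<and> C = edges_between G X (verts_of G - X))"

definition minimum_edge_cut :: "'v sgraph \<Rightarrow> 'v set set \<Rightarrow> bool" where
  "minimum_edge_cut G C \<longleftrightarrow> edge_cut G C \<and> (\<forall>D. edge_cut G D \<longrightarrow> card C \<le> card D)"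

definition trivial_edge_cut :: "'v sgraph \<Rightarrow> 'v set set \<Rightarrow> bool" where
  "trivial_edge_cut G C \<longleftrightarrow> edge_cut G C \<and> (\<exists>v\<in>verts_of G. C = incident_edges G v)"

end

(* The polytope is a tube with two caps. The tube is a perturbed prism over a (d-1)-simplex with bases
   a_0, ..., a_{d-1} and b_0, ..., b_{d-1}, whose lateral boundary carries the staircase triangulation:
   a_i b_j is an edge iff i <= j, which gives d(d+1)/2 cross edges. Beyond each of the two bases a
   cluster of d(d+1)/2 + 1 points is added so that the points of a cluster are pairwise adjacent and
   adjacent to every vertex of the base. A cut that splits one side then has at least d(d+1)/2 edges,
   and the only other cut consists of the cross edges.
   The edges are witnessed by hyperplanes that touch the point set in the two end points only, and the
   non-edges by segments through the interior; both properties survive a small perturbation, so the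
   points may be moved to general position, which makes every facet a simplex. *)
theory Submission
  imports Defs
begin

section \<open>Strictly supported pairs and general position\<close>

text \<open>The number (d^2 + d)/2 counts the d vertical edges of the prism and one diagonal for
  each of the d(d-1)/2 pairs of indices. The obstacle is the caps: a large cluster must see every
  vertex of its base and all of its own points, without hiding the edges already present. The
  cluster is therefore put very close to the base, on a curve written in coordinates relative to the
  base vertices. Hyperplanes steep enough to clear the remaining points then see the curve only
  through one polynomial in the curve parameter, with free weights, one for each base vertex.
  Exposing two curve points asks for double roots at both of them, hence degree four. Exposing a
  curve point together with a base vertex asks for the same kind of combination with one weight
  equal to zero. Four base coordinates suffice for both, which is where d \<ge> 4 enters.\<close>

definition strictly_supported :: "'a::euclidean_space set \<Rightarrow> 'a \<Rightarrow> 'a \<Rightarrow> bool" where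
  "strictly_supported S u v \<longleftrightarrow> (\<exists>n c. n \<bullet> u = c \<and> n \<bullet> v = c \<and> (\<forall>y\<in>S - {u, v}. c < n \<bullet> y))"

text \<open>For u, v in S this amounts to the midpoint lying in the interior of the hull. The form
  with functionals can be checked by linear algebra and passes to larger sets; unlike the mere
  absence of an edge, it is an open condition.\<close>

definition unsupported :: "'a::euclidean_space set \<Rightarrow> 'a \<Rightarrow> 'a \<Rightarrow> bool" where
  "unsupported S u v \<longleftrightarrow>
     (\<forall>n c. (\<forall>y\<in>S. c \<le> n \<bullet> y) \<longrightarrow> n \<bullet> u = c \<longrightarrow> n \<bullet> v = c \<longrightarrow> n = 0)"

lemma unsupported_mono: "unsupported S u v \<Longrightarrow> S \<subseteq> T \<Longrightarrow> unsupported T u v"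
  unfolding unsupported_def by blast

lemma unsupported_commute: "unsupported S u v \<longleftrightarrow> unsupported S v u"
  unfolding unsupported_def by blast

definition general_position :: "'a::euclidean_space set \<Rightarrow> bool" where
  "general_position S \<longleftrightarrow> (\<forall>T\<subseteq>S. card T \<le> DIM('a) + 1 \<longrightarrow> \<not> affine_dependent T)"

section \<open>Moving finitely many points to general position\<close>

lemma negligible_affine_hull_card_le_DIM:
  fixes T :: "'a::euclidean_space set"
  assumes "finite T" "card T \<le> DIM('a)"
  shows "negligible (affine hull T)"
proof -
  have "aff_dim (affine hull T) < int DIM('a)"
    using aff_dim_le_card[OF assms(1)] assms(2) by simp
  then show ?thesis
    by (metis affine_affine_hull affine_imp_convex low_dim_interior negligible_convex_interior less_irrefl)
qed

text \<open>Points are placed one at a time. A new one has to avoid the affine hulls of at most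
  \<open>DIM('a)\<close> points already placed; these are finitely many sets of measure zero, so
  they cannot cover a ball.\<close>

lemma general_position_perturbation:
  fixes Y :: "'a::euclidean_space set"
  assumes "finite Y" "e > 0"
  shows "\<exists>f. (\<forall>y\<in>Y. dist (f y) y < e) \<and> inj_on f Y \<and> general_position (f ` Y)"
  using assms(1)
proof (induction Y rule: finite_induct)
  case empty
  then show ?case by (auto simp: general_position_def)
next
  case (insert y Y)
  then obtain f where f: "\<forall>y\<in>Y. dist (f y) y < e" "inj_on f Y" "general_position (f ` Y)"
    by blast
  let ?H = "{T. T \<subseteq> f ` Y \<and> card T \<le> DIM('a)}"
  let ?bad = "\<Union>((\<lambda>T. affine hull T) ` ?H)"
  have fin: "finite ?H" using insert.hyps(1) by auto
  have "negligible ?bad"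
    using fin insert.hyps(1)
    by (intro negligible_Union) (auto intro: negligible_affine_hull_card_le_DIM finite_subset)
  then have "\<not> ball y e \<subseteq> ?bad"
    using open_not_negligible[of "ball y e"] negligible_subset assms(2)
    by (metis ball_eq_empty linorder_not_le open_ball)
  then obtain x where "x \<in> ball y e" and x2: "x \<notin> ?bad"
    by blast
  then have x1: "dist x y < e"
    by (simp add: dist_commute)
  have xnot: "x \<notin> f ` Y"
  proof
    assume "x \<in> f ` Y"
    \<comment> \<open>Singletons are among the subsets whose hulls are avoided, which yields
      injectivity.\<close>
    then have "{x} \<in> ?H" using DIM_positive[where 'a='a] by (auto simp: Suc_le_eq)
    moreover have "x \<in> affine hull {x}" by simp
    ultimately show False using x2 by blast
  qed
  let ?f = "f(y := x)"
  have im: "?f ` insert y Y = insert x (f ` Y)" using insert.hyps(2) by auto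
  have "general_position (insert x (f ` Y))"
    unfolding general_position_def
  proof (intro allI impI)
    fix T assume T: "T \<subseteq> insert x (f ` Y)" "card T \<le> DIM('a) + 1"
    have finT: "finite T" using T(1) insert.hyps(1) by (meson finite_imageI finite_insert finite_subset)
    show "\<not> affine_dependent T"
    proof (cases "x \<in> T")
      case False
      then show ?thesis using T f(3) unfolding general_position_def by blast
    next
      case True
      let ?T = "T - {x}"
      have sub: "?T \<subseteq> f ` Y" using T(1) by auto
      have c: "card ?T \<le> DIM('a)" using T(2) True finT by simp
      have "\<not> affine_dependent ?T" using f(3) sub c unfolding general_position_def by auto
      moreover have "x \<notin> affine hull ?T" using x2 sub c by blast
      ultimately have "\<not> affine_dependent (insert x ?T)" by (rule affine_independent_insert)
      then show ?thesis using True by (simp add: insert_absorb)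
    qed
  qed
  moreover have "inj_on ?f (insert y Y)"
    using f(2) xnot insert.hyps(2) by (auto simp: inj_on_def)
  moreover have "\<forall>z\<in>insert y Y. dist (?f z) z < e" using f(1) x1 by auto
  ultimately show ?case using im by metis
qed

text \<open>The face is the hull of some T in S. More than \<open>DIM('a)\<close> points of T would
  include the vertices of a full-dimensional simplex, so T is small enough to be affinely
  independent.\<close>

lemma general_position_face_simplex:
  fixes S :: "'a::euclidean_space set"
  assumes "finite S" "general_position S" "F face_of convex hull S" "aff_dim F < int DIM('a)"
  shows "\<exists>n. n simplex F"
proof -
  obtain T where T: "T \<subseteq> S" "F = convex hull T"
    using face_of_convex_hull_subset[OF finite_imp_compact[OF assms(1)] assms(3)] by blast
  have fin: "finite T" using T assms(1) finite_subset by blast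
  have "card T \<le> DIM('a)"
  proof (rule ccontr)
    assume "\<not> ?thesis"
    then obtain U where U: "U \<subseteq> T" "card U = DIM('a) + 1"
      by (metis Suc_eq_plus1 not_less_eq_eq obtain_subset_with_card_n)
    then have "\<not> affine_dependent U"
      using assms(2) T(1) unfolding general_position_def by auto
    then have "aff_dim U = int DIM('a)"
      using aff_dim_affine_independent[of U] U(2) by simp
    moreover have "aff_dim U \<le> aff_dim F"
      using aff_dim_subset[OF U(1)] T(2) by (simp add: aff_dim_convex_hull)
    ultimately show False using assms(4) by simp
  qed
  then have "\<not> affine_dependent T"
    using assms(2) T(1) unfolding general_position_def by auto
  then have "(int (card T) - 1) simplex F"
    unfolding simplex_def using T(2) by auto
  then show ?thesis by blast
qed

lemma general_position_simplicial:
  fixes S :: "'a::euclidean_space set"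
  assumes "finite S" "general_position S" "card S > DIM('a)"
  shows "simplicial_polytope (convex hull S)" "aff_dim (convex hull S) = int DIM('a)"
proof -
  obtain U where U: "U \<subseteq> S" "card U = DIM('a) + 1"
    using assms(3) by (metis Suc_eq_plus1 Suc_leI obtain_subset_with_card_n)
  then have "\<not> affine_dependent U"
    using assms(2) unfolding general_position_def by auto
  then have "aff_dim U = int DIM('a)"
    using aff_dim_affine_independent[of U] U(2) by simp
  then show dim: "aff_dim (convex hull S) = int DIM('a)"
    using aff_dim_subset[OF U(1)] aff_dim_le_DIM[of S] by (simp add: aff_dim_convex_hull)
  show "simplicial_polytope (convex hull S)"
    unfolding simplicial_polytope_def
  proof (intro conjI allI impI)
    show "polytope (convex hull S)" using assms(1) polytope_def by blast
  next
    fix F assume "F facet_of convex hull S"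
    then have "F face_of convex hull S" "aff_dim F < int DIM('a)"
      using dim by (auto simp: facet_of_def)
    then obtain n where n: "n simplex F"
      using general_position_face_simplex[OF assms(1,2)] by blast
    moreover have "combinatorially_isomorphic F F"
      unfolding combinatorially_isomorphic_def by (intro exI[of _ id]) (auto simp: bij_betw_def)
    ultimately show "\<exists>n. \<exists>S::'a set. n simplex S \<and> combinatorially_isomorphic F S"
      by blast
  qed
qed

section \<open>Hyperplane criteria for edges and non-edges\<close>

lemma exposed_pair_edge_of:
  fixes S :: "'a::euclidean_space set"
  assumes "finite S" "u \<in> S" "v \<in> S" "u \<noteq> v" "strictly_supported S u v"
  shows "closed_segment u v edge_of convex hull S"
proof -
  obtain n c where n: "n \<bullet> u = c" "n \<bullet> v = c" "\<forall>y\<in>S - {u, v}. c < n \<bullet> y"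
    using assms(5) unfolding strictly_supported_def by blast
  have "affine hull {u, v} \<subseteq> {x. n \<bullet> x = c}"
    using n by (intro hull_minimal) (auto simp: affine_hyperplane)
  moreover have "convex hull (S - {u, v}) \<subseteq> {x. n \<bullet> x > c}"
    using n by (intro hull_minimal) (auto simp: convex_halfspace_gt)
  ultimately have "convex hull {u, v} face_of convex hull S"
    using assms by (intro face_of_convex_hulls) auto
  moreover have "aff_dim (convex hull {u, v}) = 1"
    using assms(4) by (simp add: aff_dim_convex_hull aff_dim_2)
  ultimately show ?thesis
    by (simp add: edge_of_def segment_convex_hull)
qed

text \<open>If S has interior points, z is separated from the interior and the inequality passes to
  the closure. A flat S lies in a hyperplane, whose normal is constant on S.\<close>

lemma notin_interior_supporting_halfspace:
  fixes S :: "'a::euclidean_space set"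
  assumes "convex S" "z \<in> S" "z \<notin> interior S"
  shows "\<exists>n. n \<noteq> 0 \<and> (\<forall>x\<in>S. n \<bullet> z \<le> n \<bullet> x)"
proof (cases "interior S = {}")
  case True
  then obtain a b where "a \<noteq> 0" "S \<subseteq> {x. a \<bullet> x = b}"
    using empty_interior_subset_hyperplane assms(1) by blast
  then have "\<forall>x\<in>S. a \<bullet> z \<le> a \<bullet> x" using assms(2) by (metis (mono_tags) mem_Collect_eq order_refl subsetD)
  then show ?thesis using \<open>a \<noteq> 0\<close> by blast
next
  case False
  obtain a b where ab: "a \<noteq> 0" "a \<bullet> z \<le> b" "\<forall>x\<in>interior S. a \<bullet> x \<ge> b"
    using separating_hyperplane_sets[of "{z}" "interior S"] assms False convex_interior by auto
  have "closure (interior S) \<subseteq> {x. a \<bullet> x \<ge> b}"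
    using ab(3) by (intro closure_minimal) (auto simp: closed_halfspace_ge)
  then have "S \<subseteq> {x. a \<bullet> x \<ge> b}"
    using convex_closure_interior[OF assms(1) False] closure_subset by blast
  then have "\<forall>x\<in>S. a \<bullet> z \<le> a \<bullet> x" using ab(2) by force
  then show ?thesis using ab(1) by blast
qed

text \<open>A functional minimal at the midpoint is minimal at both ends, since its value at the
  midpoint is the average of the two.\<close>

lemma unsupported_midpoint_interior:
  fixes S :: "'a::euclidean_space set"
  assumes "u \<in> S" "v \<in> S" "unsupported S u v"
  shows "midpoint u v \<in> interior (convex hull S)"
proof (rule ccontr)
  assume *: "midpoint u v \<notin> interior (convex hull S)"
  have "closed_segment u v \<subseteq> convex hull S"
    using assms by (metis empty_subsetI hull_mono insert_subset segment_convex_hull)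
  then have "midpoint u v \<in> convex hull S" by auto
  then obtain n where n: "n \<noteq> 0" "\<forall>x\<in>convex hull S. n \<bullet> midpoint u v \<le> n \<bullet> x"
    using notin_interior_supporting_halfspace[OF convex_convex_hull _ *] by blast
  have S: "\<forall>x\<in>S. n \<bullet> midpoint u v \<le> n \<bullet> x" using n(2) by (simp add: hull_inc)
  have "2 * (n \<bullet> midpoint u v) = n \<bullet> u + n \<bullet> v"
    by (simp add: midpoint_def inner_simps)
  moreover have "n \<bullet> midpoint u v \<le> n \<bullet> u" "n \<bullet> midpoint u v \<le> n \<bullet> v"
    using S assms by auto
  ultimately have "n \<bullet> u = n \<bullet> midpoint u v \<and> n \<bullet> v = n \<bullet> midpoint u v" by argo
  then show False using assms(3) S n(1) unfolding unsupported_def by blast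
qed

section \<open>Stability of edges and non-edges under perturbation\<close>

lemma interior_convex_hull_stable:
  fixes Y :: "'a::euclidean_space set"
  assumes "finite Y" "r > 0" "ball z r \<subseteq> convex hull Y"
    "\<forall>y\<in>Y. dist (f y) y < r / 4" "dist z' z < r / 4"
  shows "z' \<in> interior (convex hull (f ` Y))"
proof -
  let ?P = "convex hull (f ` Y)"
  have "ball z' (r/4) \<subseteq> ?P"
  proof
    fix w assume w: "w \<in> ball z' (r/4)"
    show "w \<in> ?P"
    proof (rule ccontr)
      assume "w \<notin> ?P"
      moreover have "closed ?P"
        using assms(1) by (simp add: compact_imp_closed finite_imp_compact_convex_hull)
      ultimately obtain a b where ab: "a \<bullet> w < b" "\<forall>x\<in>?P. b < a \<bullet> x"
        using separating_hyperplane_closed_point[of ?P w] by auto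
      have Yne: "Y \<noteq> {}" using assms(2,3) by auto
      then have a0: "a \<noteq> 0" using ab by (metis all_not_in_conv hull_inc imageI inner_zero_left less_asym)
      have "Y \<subseteq> {x. a \<bullet> x > a \<bullet> w - norm a * (r/4)}"
      proof
        fix y assume y: "y \<in> Y"
        have "a \<bullet> w < a \<bullet> f y" using ab y by (meson hull_inc imageI less_trans)
        moreover have "\<bar>a \<bullet> (f y - y)\<bar> \<le> norm a * norm (f y - y)" by (rule Cauchy_Schwarz_ineq2)
        moreover have "norm a * norm (f y - y) \<le> norm a * (r/4)"
          using assms(4) y by (intro mult_left_mono) (auto simp: dist_norm less_imp_le)
        ultimately show "y \<in> {x. a \<bullet> x > a \<bullet> w - norm a * (r/4)}"
          by (simp add: inner_diff_right)
      qed
      then have sub: "convex hull Y \<subseteq> {x. a \<bullet> x > a \<bullet> w - norm a * (r/4)}"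
        by (intro hull_minimal) (auto simp: convex_halfspace_gt)
      \<comment> \<open>The original hull lies in an open half-space whose boundary passes at
        distance r/4 beyond w. The point \<open>?x\<close> on that boundary is still within r of z,
        the sum of three errors of at most r/4, and so lies in the hull.\<close>
      let ?x = "w - (r / 4 / norm a) *\<^sub>R a"
      have "dist ?x w = r/4" using assms(2) a0 by (simp add: dist_norm)
      then have "dist ?x z < r"
        using w assms(5,2) dist_triangle[of ?x z w] dist_triangle[of w z z']
        by (auto simp: dist_commute)
      then have "?x \<in> convex hull Y" using assms(3) by (auto simp: dist_commute)
      then have "a \<bullet> ?x > a \<bullet> w - norm a * (r/4)" using sub by blast
      moreover have "a \<bullet> ?x = a \<bullet> w - norm a * (r/4)"
        using a0 by (simp add: inner_diff_right dot_square_norm power2_eq_square)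
      ultimately show False by simp
    qed
  qed
  moreover have "z' \<in> ball z' (r/4)" using assms(2) by simp
  ultimately show ?thesis by (meson interior_maximal open_ball subsetD)
qed

text \<open>The normal n need not be constant on the moved pair, so its component along the moved
  difference \<open>e k\<close> is removed. The corrected \<open>N k\<close> is constant on the pair
  and tends to n, because n vanishes on v - u; the finitely many strict inequalities then
  persist.\<close>

lemma strictly_supported_stable:
  fixes Y :: "'a::euclidean_space set"
  assumes Y: "finite Y" "u \<in> Y" "v \<in> Y" "u \<noteq> v" "strictly_supported Y u v"
    and X: "\<And>y. y \<in> Y \<Longrightarrow> (\<lambda>k. X k y) \<longlonglongrightarrow> y"
  shows "\<forall>\<^sub>F k in sequentially. strictly_supported (X k ` Y) (X k u) (X k v)"
proof -
  obtain n c where n: "n \<bullet> u = c" "n \<bullet> v = c" "\<forall>y\<in>Y - {u, v}. c < n \<bullet> y"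
    using Y(5) unfolding strictly_supported_def by blast
  define e where "e k = X k v - X k u" for k
  define N where "N k = n - ((n \<bullet> e k) / (e k \<bullet> e k)) *\<^sub>R e k" for k
  have e: "e \<longlonglongrightarrow> v - u" unfolding e_def[abs_def] using X Y by (intro tendsto_intros) auto
  have ne: "(v - u) \<bullet> (v - u) \<noteq> 0" using Y(4) by simp
  have "N \<longlonglongrightarrow> n - ((n \<bullet> (v - u)) / ((v - u) \<bullet> (v - u))) *\<^sub>R (v - u)"
    unfolding N_def[abs_def] using e ne by (intro tendsto_intros)
  then have N: "N \<longlonglongrightarrow> n" using n by (simp add: inner_diff_right)
  have "\<forall>\<^sub>F k in sequentially. N k \<bullet> X k u < N k \<bullet> X k y" if y: "y \<in> Y - {u, v}" for y
  proof -
    have "(\<lambda>k. N k \<bullet> X k y - N k \<bullet> X k u) \<longlonglongrightarrow> n \<bullet> y - n \<bullet> u"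
      using N X Y y by (intro tendsto_intros) auto
    moreover have "n \<bullet> y - n \<bullet> u > 0" using n y by auto
    ultimately have "\<forall>\<^sub>F k in sequentially. N k \<bullet> X k y - N k \<bullet> X k u > 0"
      by (rule order_tendstoD)
    then show ?thesis by simp
  qed
  then have "\<forall>\<^sub>F k in sequentially. \<forall>y\<in>Y - {u, v}. N k \<bullet> X k u < N k \<bullet> X k y"
    using Y(1) by (intro eventually_ball_finite) auto
  moreover have "\<forall>\<^sub>F k in sequentially. e k \<noteq> 0"
    using e Y(4) by (intro tendsto_imp_eventually_ne) auto
  ultimately show ?thesis
  proof eventually_elim
    case (elim k)
    have "N k \<bullet> e k = 0" using elim(2) by (simp add: N_def inner_diff_left)
    then have "N k \<bullet> X k v = N k \<bullet> X k u" by (simp add: e_def inner_diff_right)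
    moreover have "X k ` Y - {X k u, X k v} \<subseteq> X k ` (Y - {u, v})" by auto
    ultimately show ?case unfolding strictly_supported_def using elim(1) by blast
  qed
qed

text \<open>Along perturbations that tend to the identity, every edge and every non-edge is a
  condition that holds eventually. There are finitely many pairs, so a single perturbation satisfies
  all conditions.\<close>

theorem simplicial_realization:
  fixes Y :: "'a::euclidean_space set"
  assumes Y: "finite Y" "card Y > DIM('a)" and dim: "DIM('a) \<ge> 2"
  obtains f :: "'a \<Rightarrow> 'a" where "inj_on f Y" "simplicial_polytope (convex hull (f ` Y))"
    "aff_dim (convex hull (f ` Y)) = int DIM('a)"
    "\<And>u v. u \<in> Y \<Longrightarrow> v \<in> Y \<Longrightarrow> u \<noteq> v \<Longrightarrow> strictly_supported Y u v \<Longrightarrow>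
        closed_segment (f u) (f v) edge_of convex hull (f ` Y)"
    "\<And>u v. u \<in> Y \<Longrightarrow> v \<in> Y \<Longrightarrow> unsupported Y u v \<Longrightarrow>
        \<not> closed_segment (f u) (f v) edge_of convex hull (f ` Y)"
proof -
  have "\<exists>f. (\<forall>y\<in>Y. dist (f y) y < 1 / real (Suc k)) \<and> inj_on f Y \<and> general_position (f ` Y)" (is "\<exists>f. ?Q k f") for k
    by (rule general_position_perturbation[OF Y(1)]) simp
  then have "\<exists>X. \<forall>k. ?Q k (X k)" by (intro choice allI)
  then obtain X where "\<forall>k. ?Q k (X k)" by (rule exE)
  then have X: "\<And>k y. y \<in> Y \<Longrightarrow> dist (X k y) y < 1 / real (Suc k)"
    "\<And>k. inj_on (X k) Y" "\<And>k. general_position (X k ` Y)"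
    by blast+
  have lim: "(\<lambda>k. X k y) \<longlonglongrightarrow> y" if "y \<in> Y" for y
  proof (rule metric_LIMSEQ_I)
    fix r :: real assume "r > 0"
    then obtain N where N: "1 / real (Suc N) < r" using nat_approx_posE by blast
    have "dist (X k y) y < r" if "k \<ge> N" for k
    proof -
      have "dist (X k y) y < 1 / real (Suc k)" using X(1) \<open>y \<in> Y\<close> .
      also have "\<dots> \<le> 1 / real (Suc N)" using that by (intro divide_left_mono) auto
      finally show ?thesis using N by simp
    qed
    then show "\<exists>N. \<forall>k\<ge>N. dist (X k y) y < r" by blast
  qed
  let ?E = "{(u, v) \<in> Y \<times> Y. u \<noteq> v \<and> strictly_supported Y u v}"
  let ?N = "{(u, v) \<in> Y \<times> Y. unsupported Y u v}"
  have fin: "finite ?E" "finite ?N"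
    using Y(1) by (auto intro: finite_subset[of _ "Y \<times> Y"])
  have "\<forall>\<^sub>F k in sequentially. \<forall>(u, v)\<in>?E. strictly_supported (X k ` Y) (X k u) (X k v)"
    using fin(1) Y(1) lim by (intro eventually_ball_finite) (auto intro!: strictly_supported_stable)
  moreover have "\<forall>\<^sub>F k in sequentially. \<forall>(u, v)\<in>?N.
      midpoint (X k u) (X k v) \<in> interior (convex hull (X k ` Y))"
  proof (intro eventually_ball_finite fin(2) ballI, clarify)
    fix u v assume uv: "u \<in> Y" "v \<in> Y" "unsupported Y u v"
    then have "midpoint u v \<in> interior (convex hull Y)" using unsupported_midpoint_interior by blast
    then obtain r where r: "r > 0" "ball (midpoint u v) r \<subseteq> convex hull Y"
      using mem_interior by blast
    have "\<forall>\<^sub>F k in sequentially. \<forall>y\<in>Y. dist (X k y) y < r / 4"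
      using lim r(1) Y(1) by (intro eventually_ball_finite ballI tendstoD) auto
    moreover have "(\<lambda>k. midpoint (X k u) (X k v)) \<longlonglongrightarrow> midpoint u v"
      unfolding midpoint_def using lim uv by (intro tendsto_intros) auto
    then have "\<forall>\<^sub>F k in sequentially. dist (midpoint (X k u) (X k v)) (midpoint u v) < r / 4"
      using r(1) by (intro tendstoD) auto
    ultimately show "\<forall>\<^sub>F k in sequentially. midpoint (X k u) (X k v) \<in> interior (convex hull (X k ` Y))"
      by eventually_elim (use interior_convex_hull_stable Y(1) r in blast)
  qed
  ultimately have "\<forall>\<^sub>F k in sequentially. (\<forall>(u, v)\<in>?E. strictly_supported (X k ` Y) (X k u) (X k v)) \<and>
      (\<forall>(u, v)\<in>?N. midpoint (X k u) (X k v) \<in> interior (convex hull (X k ` Y)))"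
    by eventually_elim blast
  then obtain k where k: "\<forall>(u, v)\<in>?E. strictly_supported (X k ` Y) (X k u) (X k v)"
    "\<forall>(u, v)\<in>?N. midpoint (X k u) (X k v) \<in> interior (convex hull (X k ` Y))"
    using eventually_happens' sequentially_bot by blast
  have card: "card (X k ` Y) > DIM('a)" using Y(2) X(2) by (simp add: card_image)
  note S = general_position_simplicial[OF finite_imageI[OF Y(1)] X(3) card]
  show ?thesis
  proof (rule that[of "X k", OF X(2) S])
    fix u v assume uv: "u \<in> Y" "v \<in> Y" "u \<noteq> v" "strictly_supported Y u v"
    then have "strictly_supported (X k ` Y) (X k u) (X k v)" using k(1) by blast
    moreover have "X k u \<noteq> X k v" using uv X(2) by (meson inj_onD)
    ultimately show "closed_segment (X k u) (X k v) edge_of convex hull (X k ` Y)"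
      using uv Y(1) by (intro exposed_pair_edge_of) auto
  next
    fix u v assume uv: "u \<in> Y" "v \<in> Y" "unsupported Y u v"
    then have m: "midpoint (X k u) (X k v) \<in> interior (convex hull (X k ` Y))" using k(2) by blast
    show "\<not> closed_segment (X k u) (X k v) edge_of convex hull (X k ` Y)"
    proof
      assume e: "closed_segment (X k u) (X k v) edge_of convex hull (X k ` Y)"
      \<comment> \<open>In dimension at least 2 an edge is a proper face, and a proper face misses
        the interior, where the midpoint lies.\<close>
      then have "closed_segment (X k u) (X k v) \<noteq> convex hull (X k ` Y)"
        using S(2) dim unfolding edge_of_def by (metis of_nat_1_eq_iff numeral_le_one_iff semiring_norm(69))
      then have "closed_segment (X k u) (X k v) \<inter> interior (convex hull (X k ` Y)) = {}"
        using e face_of_disjoint_interior unfolding edge_of_def by blast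
      then show False using m midpoint_in_closed_segment by blast
    qed
  qed
qed

section \<open>The curve underlying a cap\<close>

text \<open>Only two features of these quartics matter. Their positive combinations include
  \<open>1 + e (x - s)\<^sup>2 (x - t)\<^sup>2\<close> for all small \<open>s\<close>, \<open>t\<close>. The coefficient vectors \<open>(1, 1)\<close>,
  \<open>(2, -1)\<close>, \<open>(-1, 1)\<close>, \<open>(-2, -1)\<close> of \<open>x\<close> and \<open>x\<^sup>2\<close> are such that any three of them have a positive
  combination \<open>(0, 1)\<close>, so that even when one quartic is omitted the remaining ones have a combination
  that is convex near 0 with its minimum at \<open>s\<close>.\<close>

definition cap1 :: "real \<Rightarrow> real" where "cap1 x = 1 + x + x^2 + x^3 + x^4"
definition cap2 :: "real \<Rightarrow> real" where "cap2 x = 1 + 2*x - x^2 + x^4"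
definition cap3 :: "real \<Rightarrow> real" where "cap3 x = 1 - x + x^2 - x^3 + x^4"
definition cap4 :: "real \<Rightarrow> real" where "cap4 x = 1 - 2*x - x^2 + x^4"

lemmas cap_defs = cap1_def cap2_def cap3_def cap4_def

abbreviation "cap_interval \<equiv> {0..1/100::real}"

lemma cap_pos:
  assumes "x \<in> cap_interval"
  shows "cap1 x > 0" "cap2 x > 0" "cap3 x > 0" "cap4 x > 0"
proof -
  have x: "0 \<le> x" "x \<le> 1/100" using assms by auto
  have x2: "0 \<le> x^2" "x^2 \<le> x" using x by (auto simp: power2_eq_square mult_left_le)
  have x3: "0 \<le> x^3" "x^3 \<le> x^2" using x by (auto simp: power_decreasing)
  have x4: "0 \<le> x^4" using x by simp
  show "cap1 x > 0" "cap2 x > 0" "cap3 x > 0" "cap4 x > 0"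
    unfolding cap_defs using x x2 x3 x4 by linarith+
qed

text \<open>All four quartics have constant and leading coefficient 1. The sum of the weights is
  therefore both e and 1 + e (s t)^2, which forces the value of e. For s = t = 0 every weight is
  1/4, and the interval is short enough to keep the weights positive.\<close>

lemma cap_pair:
  assumes "s \<in> cap_interval" "t \<in> cap_interval"
  shows "\<exists>g1 g2 g3 g4 e. g1 > 0 \<and> g2 > 0 \<and> g3 > 0 \<and> g4 > 0 \<and> e > 0 \<and>
    (\<forall>x. g1 * cap1 x + g2 * cap2 x + g3 * cap3 x + g4 * cap4 x = 1 + e * ((x - s) * (x - t))^2)"
proof -
  have s: "0 \<le> s" "s \<le> 1/100" and t: "0 \<le> t" "t \<le> 1/100" using assms by auto
  have st: "0 \<le> s*t" "s*t \<le> 1/10000" using mult_mono[OF s(2) t(2)] s t by auto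
  have ss: "0 \<le> s* s" "s* s \<le> 1/10000" using mult_mono[OF s(2) s(2)] s by auto
  have tt: "0 \<le> t*t" "t*t \<le> 1/10000" using mult_mono[OF t(2) t(2)] t by auto
  have stst: "0 \<le> (s*t)*(s*t)" "(s*t)*(s*t) \<le> 1/10000"
    using mult_mono[of "s*t" "1/10000" "s*t" 1] st by auto
  have sts: "0 \<le> (s*t)*(s+t)" "(s*t)*(s+t) \<le> 1/10000"
    using mult_mono[of "s*t" "1/10000" "s+t" 1] st s t by auto
  define e where "e = 1 / (1 - (s*t)*(s*t))"
  have e: "e > 0" "e * (1 - (s*t)*(s*t)) = 1" using stst unfolding e_def by auto
  \<comment> \<open>These are the coefficients of x, x^2 and x^3 in ((x - s)(x - t))^2. The weights
    below solve the linear system obtained by comparing coefficients.\<close>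
  define c1 where "c1 = - 2 * ((s*t)*(s+t))"
  define c2 where "c2 = s* s + 4*(s*t) + t*t"
  define c3 where "c3 = -2*(s+t)"
  have b: "\<bar>c1\<bar> \<le> 1/10" "\<bar>c2\<bar> \<le> 1/10" "\<bar>c3\<bar> \<le> 1/10"
    unfolding c1_def c2_def c3_def using s t st ss tt sts by auto
  let ?g1 = "e * ((1+c2)/4 + c3/2)" and ?g2 = "e * ((1-c2)/4 + (c1-c3)/4)"
  let ?g3 = "e * ((1+c2)/4 - c3/2)" and ?g4 = "e * ((1-c2)/4 - (c1-c3)/4)"
  have "?g1 > 0" "?g2 > 0" "?g3 > 0" "?g4 > 0"
    using b by (intro mult_pos_pos e(1); argo)+
  moreover have "?g1 * cap1 x + ?g2 * cap2 x + ?g3 * cap3 x + ?g4 * cap4 x = 1 + e * ((x - s) * (x - t))^2" for x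
  proof -
    have "?g1 * cap1 x + ?g2 * cap2 x + ?g3 * cap3 x + ?g4 * cap4 x
        = e * (1 + c1*x + c2*x^2 + c3*x^3 + x^4)"
      unfolding cap_defs by (simp add: field_simps)
    also have "1 + c1*x + c2*x^2 + c3*x^3 + x^4 = (1 - (s*t)*(s*t)) + ((x - s) * (x - t))^2"
      unfolding c1_def c2_def c3_def by algebra
    also have "e * \<dots> = e * (1 - (s*t)*(s*t)) + e * ((x - s) * (x - t))^2" by (simp add: algebra_simps)
    finally show ?thesis using e(2) by simp
  qed
  ultimately show ?thesis using e(1) by blast
qed

text \<open>Exact expansion at s: the factor of x - s is the derivative, and the factor of (x - s)^2
  is close to g1 - g2 + g3 - g4 for x and s near 0.\<close>

lemma cap_taylor:
  "g1 * cap1 x + g2 * cap2 x + g3 * cap3 x + g4 * cap4 x =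
     (g1 * cap1 s + g2 * cap2 s + g3 * cap3 s + g4 * cap4 s) +
     (x - s) * (g1 * (1 + 2* s + 3* s^2 + 4* s^3) + g2 * (2 - 2* s + 4* s^3)
        + g3 * (-1 + 2* s - 3* s^2 + 4* s^3) + g4 * (-2 - 2* s + 4* s^3)) +
     (x - s)^2 * (g1 * (1 + (x + 2* s)) - g2 + g3 * (1 - (x + 2* s)) - g4
        + (g1+g2+g3+g4) * (x^2 + 2*x* s + 3* s^2))"
  unfolding cap_defs by algebra

text \<open>By \<open>crit\<close> the derivative vanishes at s, and \<open>conv\<close> makes the
  quadratic remainder positive, 9/10 being a lower bound for 1 + (x + 2 s) and 1 - (x + 2 s). The
  factor k scales the minimum to 1.\<close>

lemma cap_unique_min:
  assumes s: "s \<in> cap_interval" and g: "g1 \<ge> 0" "g2 \<ge> 0" "g3 \<ge> 0" "g4 \<ge> 0"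
    and crit: "g1 * (1 + 2* s + 3* s^2 + 4* s^3) + g2 * (2 - 2* s + 4* s^3)
        + g3 * (-1 + 2* s - 3* s^2 + 4* s^3) + g4 * (-2 - 2* s + 4* s^3) = 0"
    and conv: "g2 + g4 < 9/10 * (g1 + g3)"
  shows "\<exists>k>0. k * g1 * cap1 s + k * g2 * cap2 s + k * g3 * cap3 s + k * g4 * cap4 s = 1 \<and>
    (\<forall>x\<in>cap_interval - {s}. k * g1 * cap1 x + k * g2 * cap2 x + k * g3 * cap3 x + k * g4 * cap4 x > 1)"
proof -
  let ?F = "\<lambda>x. g1 * cap1 x + g2 * cap2 x + g3 * cap3 x + g4 * cap4 x"
  have "g1 > 0 \<or> g3 > 0" using conv g by argo
  then have pos: "?F s > 0"
    using cap_pos[OF s] g by (smt (verit) mult_nonneg_nonneg mult_pos_pos)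
  have more: "?F x > ?F s" if x: "x \<in> cap_interval - {s}" for x
  proof -
    have b: "0 \<le> x + 2* s" "x + 2* s \<le> 1/10" using x s by auto
    have "g1 * (1 + (x + 2* s)) \<ge> g1 * (9/10)" "g3 * (1 - (x + 2* s)) \<ge> g3 * (9/10)"
      using b by (intro mult_left_mono g; linarith)+
    moreover have "(g1+g2+g3+g4) * (x^2 + 2*x* s + 3* s^2) \<ge> 0" using g x s by auto
    ultimately have "g1 * (1 + (x + 2* s)) - g2 + g3 * (1 - (x + 2* s)) - g4
        + (g1+g2+g3+g4) * (x^2 + 2*x* s + 3* s^2) > 0"
      using conv by argo
    moreover have "(x - s)^2 > 0" using x by auto
    ultimately show ?thesis
      unfolding cap_taylor[of g1 x g2 g3 g4 s] crit by simp
  qed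
  define k where "k = 1 / ?F s"
  have dist: "k * g1 * cap1 x + k * g2 * cap2 x + k * g3 * cap3 x + k * g4 * cap4 x = k * ?F x" for x
    by (simp add: algebra_simps)
  have k: "k > 0" "k * ?F s = 1" using pos by (simp_all add: k_def)
  moreover have "k * ?F x > 1" if "x \<in> cap_interval - {s}" for x
    using mult_strict_left_mono[OF more[OF that] k(1)] k(2) by simp
  ultimately show ?thesis
    unfolding dist[symmetric] by blast
qed

lemma cap_deriv_bounds:
  assumes "s \<in> cap_interval"
  shows "1 \<le> 1 + 2* s + 3* s^2 + 4* s^3" "1 + 2* s + 3* s^2 + 4* s^3 \<le> 11/10"
    "19/10 \<le> 2 - 2* s + 4* s^3" "2 - 2* s + 4* s^3 \<le> 21/10"
    "-11/10 \<le> -1 + 2* s - 3* s^2 + 4* s^3" "-1 + 2* s - 3* s^2 + 4* s^3 \<le> -9/10"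
    "-21/10 \<le> -2 - 2* s + 4* s^3" "-2 - 2* s + 4* s^3 \<le> -19/10"
proof -
  have s: "0 \<le> s" "s \<le> 1/100" using assms by auto
  have s2: "0 \<le> s^2" "s^2 \<le> 1/100" using s mult_mono[OF s(2), of s 1] by (auto simp: power2_eq_square)
  have s3: "0 \<le> s^3" "s^3 \<le> s^2" using s by (auto simp: power_decreasing)
  show "1 \<le> 1 + 2* s + 3* s^2 + 4* s^3" "1 + 2* s + 3* s^2 + 4* s^3 \<le> 11/10"
    "19/10 \<le> 2 - 2* s + 4* s^3" "2 - 2* s + 4* s^3 \<le> 21/10"
    "-11/10 \<le> -1 + 2* s - 3* s^2 + 4* s^3" "-1 + 2* s - 3* s^2 + 4* s^3 \<le> -9/10"
    "-21/10 \<le> -2 - 2* s + 4* s^3" "-2 - 2* s + 4* s^3 \<le> -19/10"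
    using s s2 s3 by linarith+
qed

text \<open>The index i = 4 encodes that no weight vanishes. The derivatives are about 1, 2, -1, -2.
  In each case weights 1 on convex quartics (\<open>cap1\<close>, \<open>cap3\<close>) and 1/10 on
  concave ones (\<open>cap2\<close>, \<open>cap4\<close>) are prescribed, and the last weight is
  solved from the vanishing of the derivative at s.\<close>

lemma cap_vanishing_weight:
  assumes s: "s \<in> cap_interval" and i: "i < (5::nat)"
  shows "\<exists>g :: nat \<Rightarrow> real. (\<forall>k<4. if k = i then g k = 0 else g k > 0) \<and>
    g 0 * cap1 s + g 1 * cap2 s + g 2 * cap3 s + g 3 * cap4 s = 1 \<and>
    (\<forall>x\<in>cap_interval - {s}. g 0 * cap1 x + g 1 * cap2 x + g 2 * cap3 x + g 3 * cap4 x > 1)"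
proof -
  define D1 where "D1 = 1 + 2* s + 3* s^2 + 4* s^3"
  define D2 where "D2 = 2 - 2* s + 4* s^3"
  define D3 where "D3 = -1 + 2* s - 3* s^2 + 4* s^3"
  define D4 where "D4 = -2 - 2* s + 4* s^3"
  have D: "1 \<le> D1" "D1 \<le> 11/10" "19/10 \<le> D2" "D2 \<le> 21/10"
    "-11/10 \<le> D3" "D3 \<le> -9/10" "-21/10 \<le> D4" "D4 \<le> -19/10"
    unfolding D1_def D2_def D3_def D4_def by (rule cap_deriv_bounds[OF s])+
  have *: ?thesis if g: "\<forall>k<4. if k = i then g k = 0 else g k > 0"
    "g 0 * D1 + g 1 * D2 + g 2 * D3 + g 3 * D4 = 0" "g 1 + g 3 < 9/10 * (g 0 + g 2)"
  for g :: "nat \<Rightarrow> real"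
  proof -
    have nn: "\<forall>k<4. g k \<ge> 0" using g(1) by (metis less_eq_real_def)
    then obtain k where "k > 0"
      "k * g 0 * cap1 s + k * g 1 * cap2 s + k * g 2 * cap3 s + k * g 3 * cap4 s = 1"
      "\<forall>x\<in>cap_interval - {s}. k * g 0 * cap1 x + k * g 1 * cap2 x + k * g 2 * cap3 x + k * g 3 * cap4 x > 1"
      using cap_unique_min[OF s, of "g 0" "g 1" "g 2" "g 3"] g(2,3)
      unfolding D1_def D2_def D3_def D4_def by auto
    then show ?thesis using g(1) by (intro exI[of _ "\<lambda>j. k * g j"]) auto
  qed
  have all4: "(\<forall>k<4. P k) \<longleftrightarrow> P 0 \<and> P 1 \<and> P 2 \<and> P 3" for P :: "nat \<Rightarrow> bool"
    by (auto simp: numeral_eq_Suc less_Suc_eq)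
  consider "i = 0" | "i = 1" | "i = 2" | "i = 3" | "i = 4" using i by linarith
  then show ?thesis
  proof cases
    case 1
    show ?thesis
      using D 1 by (intro *[of "(\<lambda>_. 0)(1 := (- D3 - D4/10) / D2, 2 := 1, 3 := 1/10)"])
        (auto simp: all4 field_simps)
  next
    case 2
    show ?thesis
      using D 2 by (intro *[of "(\<lambda>_. 0)(0 := (- D3 - D4/10) / D1, 2 := 1, 3 := 1/10)"])
        (auto simp: all4 field_simps)
  next
    case 3
    show ?thesis
      using D 3 by (intro *[of "(\<lambda>_. 0)(0 := 1, 1 := 1/10, 3 := (D1 + D2/10) / (-D4))"])
        (auto simp: all4 field_simps)
  next
    case 4
    show ?thesis
      using D 4 by (intro *[of "(\<lambda>_. 0)(0 := 1, 1 := 1/10, 2 := (D1 + D2/10) / (-D3))"])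
        (auto simp: all4 field_simps)
  next
    case 5
    show ?thesis
      using D 5 by (intro *[of "(\<lambda>_. 0)(0 := 1, 1 := 1/10, 3 := 1/10, 2 := (D1 + D2/10 + D4/10) / (-D3))"])
        (auto simp: all4 field_simps)
  qed
qed

text \<open>The numbers \<open>f x a\<close> will be homogeneous coordinates of a curve point
  relative to a simplex A, and g the values of an affine functional on A. The two families of
  weights prepare hyperplanes through two curve points, and through a curve point and the vertex i.
  Four coordinates carry the quartics, the others are constantly 1.\<close>

lemma cap_curve:
  assumes A: "finite A" "card A \<ge> 4"
  shows "\<exists>f :: real \<Rightarrow> 'b \<Rightarrow> real.
    (\<forall>x\<in>cap_interval. \<forall>a\<in>A. f x a > 0) \<and>
    (\<forall>s\<in>cap_interval. \<forall>t\<in>cap_interval. \<exists>g. (\<forall>a\<in>A. g a > 0) \<and>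
        (\<Sum>a\<in>A. g a * f s a) = 1 \<and> (\<Sum>a\<in>A. g a * f t a) = 1 \<and>
        (\<forall>x\<in>cap_interval - {s, t}. (\<Sum>a\<in>A. g a * f x a) > 1)) \<and>
    (\<forall>s\<in>cap_interval. \<forall>i\<in>A. \<exists>g. g i = 0 \<and> (\<forall>a\<in>A - {i}. g a > 0) \<and>
        (\<Sum>a\<in>A. g a * f s a) = 1 \<and> (\<forall>x\<in>cap_interval - {s}. (\<Sum>a\<in>A. g a * f x a) > 1))"
proof -
  obtain B where B: "B \<subseteq> A" "card B = 4" using A(2) by (meson obtain_subset_with_card_n)
  then obtain h :: "nat \<Rightarrow> 'b" where h: "bij_betw h {..<4} B"
    using A(1) by (metis card_lessThan finite_lessThan finite_same_card_bij finite_subset)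
  define R where "R = A - B"
  have finR: "finite R" "finite B" using A(1) B(1) finite_subset by (auto simp: R_def)
  define c where "c k x = (if k = 0 then cap1 x else if k = 1 then cap2 x else
      if k = (2::nat) then cap3 x else cap4 x)" for k x
  define inv where "inv = the_inv_into {..<4} h"
  have inv: "inv (h k) = k" if "k < 4" for k
    using that h unfolding inv_def bij_betw_def by (simp add: the_inv_into_f_f)
  define f where "f x a = (if a \<in> B then c (inv a) x else 1)" for x a
  have split: "(\<Sum>a\<in>A. G a * f x a) =
      G (h 0) * cap1 x + G (h 1) * cap2 x + G (h 2) * cap3 x + G (h 3) * cap4 x + (\<Sum>a\<in>R. G a)" for G x
  proof -
    have "(\<Sum>a\<in>A. G a * f x a) = (\<Sum>a\<in>B. G a * f x a) + (\<Sum>a\<in>R. G a * f x a)"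
      unfolding R_def by (subst sum.subset_diff[OF B(1) A(1)]) simp
    also have "(\<Sum>a\<in>R. G a * f x a) = (\<Sum>a\<in>R. G a)" by (simp add: f_def R_def)
    also have "(\<Sum>a\<in>B. G a * f x a) = (\<Sum>k<4. G (h k) * f x (h k))"
      using sum.reindex_bij_betw[OF h, of "\<lambda>a. G a * f x a"] by simp
    also have "\<dots> = (\<Sum>k<4. G (h k) * c k x)"
      using h inv by (intro sum.cong) (auto simp: f_def bij_betw_def)
    also have "\<dots> = G (h 0) * cap1 x + G (h 1) * cap2 x + G (h 2) * cap3 x + G (h 3) * cap4 x"
      by (simp add: numeral_eq_Suc c_def)
    finally show ?thesis .
  qed
  \<comment> \<open>The constant coordinates add \<open>sum r R\<close> to every sum. Scaling the
    quartic weights by \<open>1 - sum r R\<close> keeps the level 1 and, while this factor is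
    positive, the side on which a value lies.\<close>
  define mix where "mix g r a = (if a \<in> B then (1 - sum r R) * g (inv a) else r a)"
    for g :: "nat \<Rightarrow> real" and r :: "'b \<Rightarrow> real" and a
  have mix_h: "mix g r (h k) = (1 - sum r R) * g k" if "k < 4" for g r k
    using that h inv by (auto simp: mix_def bij_betw_def)
  have mix: "(\<Sum>a\<in>A. mix g r a * f x a) =
     1 + (1 - sum r R) * (g 0 * cap1 x + g 1 * cap2 x + g 2 * cap3 x + g 3 * cap4 x - 1)" for g r x
  proof -
    have "(\<Sum>a\<in>R. mix g r a) = sum r R" by (intro sum.cong) (auto simp: mix_def R_def)
    then show ?thesis unfolding split by (simp add: mix_h algebra_simps)
  qed
  have invB: "inv a < 4" "h (inv a) = a" if "a \<in> B" for a
    using that h inv by (auto simp: bij_betw_def)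
  define rho where "rho = 1 / (2 * (real (card R) + 1))"
  have rho: "rho > 0" "real (card R) * rho < 1" unfolding rho_def by (auto simp: field_simps)
  show ?thesis
  proof (intro exI[of _ f] conjI ballI)
    fix x a assume "x \<in> cap_interval" "a \<in> A"
    then show "f x a > 0" using cap_pos by (auto simp: f_def c_def)
  next
    fix s t assume st: "s \<in> cap_interval" "t \<in> cap_interval"
    then obtain g1 g2 g3 g4 e where g: "g1 > 0" "g2 > 0" "g3 > 0" "g4 > 0" "e > 0"
      "\<And>x. g1 * cap1 x + g2 * cap2 x + g3 * cap3 x + g4 * cap4 x = 1 + e * ((x - s) * (x - t))^2"
      using cap_pair by metis
    define g where "g k = (if k = 0 then g1 else if k = 1 then g2 else if k = (2::nat) then g3 else g4)" for k
    let ?G = "mix g (\<lambda>_. rho)"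
    have G: "(\<Sum>a\<in>A. ?G a * f x a) = 1 + (1 - real (card R) * rho) * (e * ((x - s) * (x - t))^2)" for x
      unfolding mix using g(6)[of x] by (simp add: g_def)
    have "\<forall>a\<in>A. ?G a > 0" using rho g(1-5) by (auto simp: mix_def g_def)
    moreover have "(\<Sum>a\<in>A. ?G a * f x a) > 1" if "x \<in> cap_interval - {s, t}" for x
      unfolding G using rho g(5) that by auto
    ultimately show "\<exists>g. (\<forall>a\<in>A. g a > 0) \<and>
        (\<Sum>a\<in>A. g a * f s a) = 1 \<and> (\<Sum>a\<in>A. g a * f t a) = 1 \<and>
        (\<forall>x\<in>cap_interval - {s, t}. (\<Sum>a\<in>A. g a * f x a) > 1)"
      using G by (intro exI[of _ ?G]) auto
  next
    fix s i assume s: "s \<in> cap_interval" and i: "i \<in> A"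
    \<comment> \<open>If i is one of the constant coordinates, the zero weight is placed in r and
      all four quartic weights stay positive.\<close>
    define j where "j = (if i \<in> B then inv i else 4)"
    have "j < 5" using invB by (force simp: j_def)
    then obtain g :: "nat \<Rightarrow> real" where g: "\<forall>k<4. if k = j then g k = 0 else g k > 0"
      "g 0 * cap1 s + g 1 * cap2 s + g 2 * cap3 s + g 3 * cap4 s = 1"
      "\<forall>x\<in>cap_interval - {s}. g 0 * cap1 x + g 1 * cap2 x + g 2 * cap3 x + g 3 * cap4 x > 1"
      using cap_vanishing_weight[OF s] by blast
    define r where "r a = (if a = i then 0 else rho)" for a
    have "sum r R \<le> (\<Sum>a\<in>R. rho)" using rho by (intro sum_mono) (auto simp: r_def)
    then have r: "sum r R < 1" using rho by simp
    let ?G = "mix g r"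
    have "?G i = 0" using g(1) invB by (auto simp: mix_def j_def r_def)
    moreover have "?G a > 0" if "a \<in> A - {i}" for a
    proof (cases "a \<in> B")
      case True
      then have "inv a \<noteq> j" using that invB(1)[OF True] invB(2)[OF True] invB(2)[of i] by (auto simp: j_def)
      then have "g (inv a) > 0" using g(1) invB(1)[OF True] by metis
      then show ?thesis using True r by (simp add: mix_def)
    next
      case False
      then show ?thesis using that rho by (simp add: mix_def r_def)
    qed
    moreover have "(\<Sum>a\<in>A. ?G a * f s a) = 1" unfolding mix using g(2) by simp
    moreover have "(\<Sum>a\<in>A. ?G a * f x a) > 1" if "x \<in> cap_interval - {s}" for x
      unfolding mix using g(3) that r by auto
    ultimately show "\<exists>g. g i = 0 \<and> (\<forall>a\<in>A - {i}. g a > 0) \<and>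
        (\<Sum>a\<in>A. g a * f s a) = 1 \<and> (\<forall>x\<in>cap_interval - {s}. (\<Sum>a\<in>A. g a * f x a) > 1)"
      by (intro exI[of _ ?G]) blast
  qed
qed

section \<open>Adding a cap beyond a simplex\<close>

lemma affine_functional_exists:
  fixes A :: "'a::euclidean_space set" and g :: "'a \<Rightarrow> real"
  assumes "\<not> affine_dependent A" "A \<noteq> {}"
  shows "\<exists>n c. \<forall>a\<in>A. n \<bullet> a - c = g a"
proof -
  obtain b where b: "b \<in> A" using assms(2) by blast
  let ?D = "(\<lambda>x. x - b) ` (A - {b})"
  have ind: "independent ?D"
    using affine_dependent_iff_dependent2[OF b] assms(1) by (simp add: image_def)
  obtain L :: "'a \<Rightarrow> real" where L: "linear L" "\<forall>x\<in>?D. L x = g (x + b) - g b"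
    using linear_independent_extend[OF ind, of "\<lambda>x. g (x + b) - g b"] by blast
  let ?n = "adjoint L 1"
  have n: "?n \<bullet> x = L x" for x
    using adjoint_works[OF L(1), of x 1] by (simp add: inner_commute)
  have "?n \<bullet> a - (?n \<bullet> b - g b) = g a" if "a \<in> A" for a
  proof (cases "a = b")
    case False
    then have "?n \<bullet> (a - b) = g a - g b" unfolding n using L(2) that by auto
    then show ?thesis by (simp add: inner_diff_right)
  qed simp
  then show ?thesis by blast
qed

text \<open>Strict support can be lost when points are added, so its survival is part of the
  conclusion, whereas \<open>unsupported\<close> passes to larger sets. The functional n1 keeps the
  new points on the proper side of the opposite base, where another cap can then be glued.\<close>

lemma cap_glue:
  fixes A Y :: "'a::euclidean_space set" and m :: nat
  assumes A: "\<not> affine_dependent A" "card A = DIM('a)" "DIM('a) \<ge> 4"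
    and Y: "finite Y" "Y \<noteq> {}"
    and n0: "\<And>a. a \<in> A \<Longrightarrow> n0 \<bullet> a = c0" "\<And>y. y \<in> Y \<Longrightarrow> n0 \<bullet> y > c0"
    and n1: "\<And>a. a \<in> A \<Longrightarrow> n1 \<bullet> a > c1"
  shows "\<exists>K. finite K \<and> card K = m \<and> (\<forall>p\<in>K. n0 \<bullet> p < c0) \<and> (\<forall>p\<in>K. n1 \<bullet> p > c1) \<and>
    (\<forall>u\<in>A \<union> Y. \<forall>v\<in>A \<union> Y. strictly_supported (A \<union> Y) u v \<longrightarrow> strictly_supported (K \<union> A \<union> Y) u v) \<and>
    (\<forall>p\<in>K. \<forall>q\<in>K \<union> A. strictly_supported (K \<union> A \<union> Y) p q) \<and>
    (\<forall>p\<in>K. \<forall>y\<in>Y. unsupported (K \<union> A \<union> Y) p y)"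
proof -
  have finA: "finite A" using A(1) aff_independent_finite by blast
  have c4: "card A \<ge> 4" using A by simp
  have neA: "A \<noteq> {}" using A by auto
  obtain f :: "real \<Rightarrow> 'a \<Rightarrow> real" where
    f0: "\<forall>x\<in>cap_interval. \<forall>a\<in>A. f x a > 0" and
    f2: "\<forall>s\<in>cap_interval. \<forall>t\<in>cap_interval. \<exists>g. (\<forall>a\<in>A. g a > 0) \<and>
        (\<Sum>a\<in>A. g a * f s a) = 1 \<and> (\<Sum>a\<in>A. g a * f t a) = 1 \<and>
        (\<forall>x\<in>cap_interval - {s, t}. (\<Sum>a\<in>A. g a * f x a) > 1)" and
    f1: "\<forall>s\<in>cap_interval. \<forall>i\<in>A. \<exists>g. g i = 0 \<and> (\<forall>a\<in>A - {i}. g a > 0) \<and>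
        (\<Sum>a\<in>A. g a * f s a) = 1 \<and> (\<forall>x\<in>cap_interval - {s}. (\<Sum>a\<in>A. g a * f x a) > 1)"
    using cap_curve[OF finA c4] by (elim exE conjE)
  have "infinite cap_interval" by (simp add: infinite_Icc)
  then obtain X where X: "X \<subseteq> cap_interval" "finite X" "card X = m"
    using infinite_arbitrarily_large by metis
  define F where "F x = (\<Sum>a\<in>A. f x a)" for x
  have F: "F x > 0" if "x \<in> X" for x
    unfolding F_def using f0 that finA neA X by (intro sum_pos) auto
  obtain z where z: "z \<in> Y" using Y(2) by blast
  have "affine hull A \<subseteq> {x. n0 \<bullet> x = c0}"
    using n0(1) by (intro hull_minimal) (auto simp: affine_hyperplane)
  then have zA: "z \<notin> affine hull A" using n0(2)[OF z] by auto
  then have ind: "\<not> affine_dependent (insert z A)" using A(1) by (rule affine_independent_insert[rotated])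
  have zA': "z \<notin> A" using zA by (meson hull_inc)
  have span: "affine hull (insert z A) = UNIV"
    using ind zA' finA A(2) by (intro affine_independent_span_eq) auto
  \<comment> \<open>For an affine functional with value \<open>g a\<close> at \<open>a\<close> and \<open>1 / e\<close> at \<open>z\<close>, the value at \<open>p e x\<close> is a
    positive multiple of \<open>(\<Sum>a\<in>A. g a * f x a) - 1\<close>, while the values on \<open>Y\<close> become positive as \<open>e\<close>
    tends to 0.\<close>
  define p where "p e x = (1 / (F x - e)) *\<^sub>R ((\<Sum>a\<in>A. f x a *\<^sub>R a) - e *\<^sub>R z)" for e x
  have p: "(F x - e) * (n \<bullet> p e x - c) = (\<Sum>a\<in>A. f x a * (n \<bullet> a - c)) - e * (n \<bullet> z - c)"
    if "e < F x" for e x n c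
  proof -
    have "(F x - e) * (n \<bullet> p e x) = (\<Sum>a\<in>A. f x a * (n \<bullet> a)) - e * (n \<bullet> z)"
      using that by (simp add: p_def inner_diff_right inner_sum_right)
    then show ?thesis
      by (simp add: F_def algebra_simps sum_subtractf sum_distrib_left)
  qed
  have posD: "n \<bullet> q > c" if "(F x - e) * (n \<bullet> q - c) > 0" "e < F x" for n q c x e
    using zero_less_mult_pos[OF that(1)] that(2) by simp
  let ?F = "at_right (0::real)"
  have e0: "\<forall>\<^sub>F e in ?F. e > 0" by (rule eventually_at_right_less)
  have small: "\<forall>\<^sub>F e in ?F. e * r < q" if "q > 0" for r q :: real
  proof -
    have "((\<lambda>e. e * r) \<longlongrightarrow> 0 * r) ?F" by (intro tendsto_intros)
    then show ?thesis using that by (intro order_tendstoD(2)[of _ "0 * r"]) auto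
  qed
  have eF: "\<forall>\<^sub>F e in ?F. \<forall>x\<in>X. e < F x"
    using small[of _ 1] F X(2) by (intro eventually_ball_finite) auto
  \<comment> \<open>As e tends to 0, \<open>p e x\<close> tends to a combination of A with all
    weights positive. A half-space containing A, with one vertex b off its boundary, thus eventually
    contains the new points.\<close>
  have near: "\<forall>\<^sub>F e in ?F. \<forall>x\<in>X. n \<bullet> p e x > c"
    if "\<And>a. a \<in> A \<Longrightarrow> n \<bullet> a \<ge> c" "b \<in> A" "n \<bullet> b > c" for n b c
  proof -
    have "\<forall>\<^sub>F e in ?F. \<forall>x\<in>X. e * (n \<bullet> z - c) < (\<Sum>a\<in>A. f x a * (n \<bullet> a - c))"
    proof (intro eventually_ball_finite X(2) ballI small)
      fix x assume x: "x \<in> X"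
      show "(\<Sum>a\<in>A. f x a * (n \<bullet> a - c)) > 0"
      proof (rule sum_pos2[of A b])
        have fx: "f x a > 0" if "a \<in> A" for a using f0 x X(1) that by blast
        show "f x b * (n \<bullet> b - c) > 0" using fx \<open>b \<in> A\<close> \<open>n \<bullet> b > c\<close> by simp
        show "f x a * (n \<bullet> a - c) \<ge> 0" if "a \<in> A" for a
          using fx[OF that] \<open>\<And>a. a \<in> A \<Longrightarrow> n \<bullet> a \<ge> c\<close>[OF that] by simp
      qed (use finA \<open>b \<in> A\<close> in auto)
    qed
    with eF show ?thesis
    proof eventually_elim
      case (elim e)
      show ?case
      proof
        fix x assume x: "x \<in> X"
        then have "(F x - e) * (n \<bullet> p e x - c) > 0" using elim p by force
        then show "n \<bullet> p e x > c" using elim(1) x by (blast intro: posD)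
      qed
    qed
  qed
  define d where "d = n0 \<bullet> z - c0"
  have d: "d > 0" using n0(2)[OF z] by (simp add: d_def)
  have lift: "\<forall>\<^sub>F e in ?F. \<exists>n c. (\<forall>a\<in>A. n \<bullet> a - c = g a) \<and> (\<forall>y\<in>Y. n \<bullet> y > c) \<and>
      (\<forall>x\<in>X. (F x - e) * (n \<bullet> p e x - c) = (\<Sum>a\<in>A. g a * f x a) - 1)" for g
  proof -
    obtain k b where kb: "\<forall>a\<in>insert z A. k \<bullet> a - b = (if a = z then 0 else g a)"
      using affine_functional_exists[OF ind insert_not_empty, of "\<lambda>a. if a = z then 0 else g a"] by blast
    have "\<forall>\<^sub>F e in ?F. \<forall>y\<in>Y. e * (- d * (k \<bullet> y - b)) < n0 \<bullet> y - c0"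
      using n0(2) Y(1) by (intro eventually_ball_finite small ballI) auto
    with eF e0 show ?thesis
    proof eventually_elim
      case (elim e)
      \<comment> \<open>The multiple of n0 does not change the values on A, lifts the value at z
        from 0 to 1/e, and outweighs k on Y, where n0 exceeds c0.\<close>
      let ?n = "k + (1 / (d * e)) *\<^sub>R n0" and ?c = "b + (1 / (d * e)) * c0"
      have n: "?n \<bullet> x - ?c = (k \<bullet> x - b) + (n0 \<bullet> x - c0) / (d * e)" for x
        by (simp add: inner_add_left algebra_simps diff_divide_distrib)
      have nA: "\<forall>a\<in>A. ?n \<bullet> a - ?c = g a"
        unfolding n using kb n0(1) zA' by auto
      moreover have "?n \<bullet> y > ?c" if "y \<in> Y" for y
      proof -
        have "e * (- d * (k \<bullet> y - b)) < n0 \<bullet> y - c0" using elim that by blast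
        then have "0 < (k \<bullet> y - b) * (d * e) + (n0 \<bullet> y - c0)" by (simp add: algebra_simps)
        then have "?n \<bullet> y - ?c > 0" unfolding n using elim d by (simp add: field_simps)
        then show ?thesis by simp
      qed
      moreover have nz: "?n \<bullet> z - ?c = 1 / e"
        unfolding n using kb d by (simp add: d_def[symmetric])
      have "(F x - e) * (?n \<bullet> p e x - ?c) = (\<Sum>a\<in>A. g a * f x a) - 1" if "x \<in> X" for x
      proof -
        have "(F x - e) * (?n \<bullet> p e x - ?c) = (\<Sum>a\<in>A. f x a * (?n \<bullet> a - ?c)) - e * (?n \<bullet> z - ?c)"
          using elim that by (intro p) auto
        also have "(\<Sum>a\<in>A. f x a * (?n \<bullet> a - ?c)) = (\<Sum>a\<in>A. g a * f x a)"
          using nA by (intro sum.cong) auto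
        finally show ?thesis using nz elim(2) by simp
      qed
      ultimately show ?case by blast
    qed
  qed
  have E2: "\<forall>\<^sub>F e in ?F. strictly_supported (p e ` X \<union> A \<union> Y) u v" if uv: "strictly_supported (A \<union> Y) u v" for u v
  proof -
    obtain n c where n: "n \<bullet> u = c" "n \<bullet> v = c" "\<forall>y\<in>(A \<union> Y) - {u, v}. c < n \<bullet> y"
      using uv unfolding strictly_supported_def by blast
    \<comment> \<open>A has at least four points, so one of them lies strictly above the hyperplane,
      as \<open>near\<close> requires.\<close>
    have "\<not> A \<subseteq> {u, v}"
      using A(2,3) card_mono[of "{u,v}" A] card_insert_le_m1[of 2 "{v}" u] by auto
    then obtain b where b: "b \<in> A" "n \<bullet> b > c" using n by blast
    have "\<forall>\<^sub>F e in ?F. \<forall>x\<in>X. n \<bullet> p e x > c"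
    proof (rule near[OF _ b])
      fix a assume "a \<in> A"
      then show "n \<bullet> a \<ge> c" using n by (cases "a \<in> {u, v}") (auto intro: less_imp_le)
    qed
    then show ?thesis
    proof eventually_elim
      case (elim e)
      show ?case unfolding strictly_supported_def using n elim by (intro exI[of _ n] exI[of _ c]) auto
    qed
  qed
  have E3: "\<forall>\<^sub>F e in ?F. strictly_supported (p e ` X \<union> A \<union> Y) (p e s) (p e t)" if st: "s \<in> X" "t \<in> X" for s t
  proof -
    obtain g where g: "\<forall>a\<in>A. g a > 0"
      "(\<Sum>a\<in>A. g a * f s a) = 1" "(\<Sum>a\<in>A. g a * f t a) = 1"
      "\<forall>x\<in>cap_interval - {s, t}. (\<Sum>a\<in>A. g a * f x a) > 1"
      using f2 st X(1) by blast
    show ?thesis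
      using lift[of g] eF
    proof eventually_elim
      case (elim e)
      then obtain n c where n: "\<forall>a\<in>A. n \<bullet> a - c = g a" "\<forall>y\<in>Y. n \<bullet> y > c"
        "\<forall>x\<in>X. (F x - e) * (n \<bullet> p e x - c) = (\<Sum>a\<in>A. g a * f x a) - 1" by blast
      have "n \<bullet> p e s = c" "n \<bullet> p e t = c"
        using n(3) g(2,3) st elim(2) by force+
      moreover have "n \<bullet> p e x > c" if "x \<in> X - {s, t}" for x
      proof -
        have "(F x - e) * (n \<bullet> p e x - c) > 0" using n(3) g(4) that X(1) by force
        then show ?thesis using elim(2) that by (blast intro: posD)
      qed
      moreover have "n \<bullet> a > c" if "a \<in> A" for a using n(1) g(1) that by force
      ultimately show ?case unfolding strictly_supported_def using n(2)
        by (intro exI[of _ n] exI[of _ c]) auto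
    qed
  qed
  have E4: "\<forall>\<^sub>F e in ?F. \<exists>n c. n \<bullet> p e s = c \<and> n \<bullet> i = c \<and> (\<forall>x\<in>X - {s}. n \<bullet> p e x > c) \<and>
      (\<forall>a\<in>A - {i}. n \<bullet> a > c) \<and> (\<forall>y\<in>Y. n \<bullet> y > c)" if si: "s \<in> X" "i \<in> A" for s i
  proof -
    obtain g where g: "g i = 0" "\<forall>a\<in>A - {i}. g a > 0"
      "(\<Sum>a\<in>A. g a * f s a) = 1" "\<forall>x\<in>cap_interval - {s}. (\<Sum>a\<in>A. g a * f x a) > 1"
      using f1 si X(1) by blast
    show ?thesis
      using lift[of g] eF
    proof eventually_elim
      case (elim e)
      then obtain n c where n: "\<forall>a\<in>A. n \<bullet> a - c = g a" "\<forall>y\<in>Y. n \<bullet> y > c"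
        "\<forall>x\<in>X. (F x - e) * (n \<bullet> p e x - c) = (\<Sum>a\<in>A. g a * f x a) - 1" by blast
      have "n \<bullet> p e s = c" using n(3) g(3) si elim(2) by force
      moreover have "n \<bullet> i = c" using n(1) g(1) si by force
      moreover have "n \<bullet> p e x > c" if "x \<in> X - {s}" for x
      proof -
        have "(F x - e) * (n \<bullet> p e x - c) > 0" using n(3) g(4) that X(1) by force
        then show ?thesis using elim(2) that by (blast intro: posD)
      qed
      moreover have "n \<bullet> a > c" if "a \<in> A - {i}" for a using n(1) g(2) that by force
      ultimately show ?case using n(2) by blast
    qed
  qed
  \<comment> \<open>The combination of \<open>p e x\<close> and y with weights F x - e and e / u z
    cancels z and has positive coefficients on A for small e: the segment crosses the relative
    interior of the base. A functional minimal at both ends is then constant on A, hence at z, hence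
    everywhere.\<close>
  have E5: "\<forall>\<^sub>F e in ?F. unsupported (p e ` X \<union> A \<union> Y) (p e x) y" if xy: "x \<in> X" "y \<in> Y" for x y
  proof -
    obtain u where u: "sum u (insert z A) = 1" "(\<Sum>v\<in>insert z A. u v *\<^sub>R v) = y"
      using span affine_hull_finite[of "insert z A"] finA by auto
    have Ly: "n \<bullet> y - c = u z * (n \<bullet> z - c) + (\<Sum>a\<in>A. u a * (n \<bullet> a - c))" for n c
    proof -
      have "n \<bullet> y - c = (\<Sum>v\<in>insert z A. u v * (n \<bullet> v)) - (\<Sum>v\<in>insert z A. u v) * c"
        unfolding u(1) by (simp add: u(2)[symmetric] inner_sum_right)
      also have "\<dots> = (\<Sum>v\<in>insert z A. u v * (n \<bullet> v - c))"
        by (simp add: sum_distrib_right sum_subtractf right_diff_distrib)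
      finally show ?thesis using finA zA' by simp
    qed
    have "u z * d > 0" using Ly[of n0 c0] n0(1) n0(2)[OF xy(2)] by (simp add: d_def)
    then have uz: "u z > 0" using d by (simp add: zero_less_mult_iff)
    have "\<forall>\<^sub>F e in ?F. \<forall>a\<in>A. e * (- u a / u z) < f x a"
      using f0 xy X(1) finA by (intro eventually_ball_finite small ballI) auto
    with eF e0 show ?thesis
    proof eventually_elim
      case (elim e)
      show ?case
        unfolding unsupported_def
      proof (intro allI impI)
        fix n c assume n: "\<forall>v\<in>p e ` X \<union> A \<union> Y. c \<le> n \<bullet> v" "n \<bullet> p e x = c" "n \<bullet> y = c"
        have z: "n \<bullet> z - c = - (\<Sum>a\<in>A. u a * (n \<bullet> a - c)) / u z"
          using Ly[of n c] n(3) uz by (simp add: field_simps)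
        have "0 = (\<Sum>a\<in>A. f x a * (n \<bullet> a - c)) - e * (n \<bullet> z - c)"
          using p[of e x n c] elim(1) xy n(2) by simp
        also have "\<dots> = (\<Sum>a\<in>A. (f x a + e * u a / u z) * (n \<bullet> a - c))"
          unfolding z by (simp add: sum_distrib_left sum_divide_distrib sum.distrib[symmetric] algebra_simps)
        finally have "(\<Sum>a\<in>A. (f x a + e * u a / u z) * (n \<bullet> a - c)) = 0" by simp
        moreover have pos: "f x a + e * u a / u z > 0" if "a \<in> A" for a
          using elim(3) that by force
        moreover have "n \<bullet> a - c \<ge> 0" if "a \<in> A" for a using n(1) that by auto
        ultimately have "\<forall>a\<in>A. (f x a + e * u a / u z) * (n \<bullet> a - c) = 0"
          using finA by (subst (asm) sum_nonneg_eq_0_iff) (auto intro!: mult_nonneg_nonneg less_imp_le[OF pos])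
        then have nA: "\<forall>a\<in>A. n \<bullet> a = c" using pos by fastforce
        then have "n \<bullet> z = c" using z by simp
        then have "affine hull (insert z A) \<subseteq> {v. n \<bullet> v = c}"
          using nA by (intro hull_minimal) (auto simp: affine_hyperplane)
        then have "n \<bullet> v = c" for v using span by auto
        from this[of n] this[of 0] show "n = 0" by simp
      qed
    qed
  qed
  have "\<forall>\<^sub>F e in ?F. strictly_supported (A \<union> Y) u v \<longrightarrow> strictly_supported (p e ` X \<union> A \<union> Y) u v" for u v
    by (cases "strictly_supported (A \<union> Y) u v") (simp_all add: E2)
  then have "\<forall>\<^sub>F e in ?F. \<forall>u\<in>A \<union> Y. \<forall>v\<in>A \<union> Y.
      strictly_supported (A \<union> Y) u v \<longrightarrow> strictly_supported (p e ` X \<union> A \<union> Y) u v"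
    using finA Y(1) by (intro eventually_ball_finite ballI finite_UnI)
  moreover have "\<forall>\<^sub>F e in ?F. \<forall>s\<in>X. \<forall>t\<in>X. strictly_supported (p e ` X \<union> A \<union> Y) (p e s) (p e t)"
    by (intro eventually_ball_finite ballI X(2) E3)
  moreover have "\<forall>\<^sub>F e in ?F. \<forall>s\<in>X. \<forall>i\<in>A.
      \<exists>n c. n \<bullet> p e s = c \<and> n \<bullet> i = c \<and> (\<forall>x\<in>X - {s}. n \<bullet> p e x > c) \<and>
      (\<forall>a\<in>A - {i}. n \<bullet> a > c) \<and> (\<forall>y\<in>Y. n \<bullet> y > c)"
    by (intro eventually_ball_finite ballI X(2) finA E4)
  moreover have "\<forall>\<^sub>F e in ?F. \<forall>x\<in>X. \<forall>y\<in>Y. unsupported (p e ` X \<union> A \<union> Y) (p e x) y"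
    by (intro eventually_ball_finite ballI X(2) Y(1) E5)
  moreover have "\<forall>\<^sub>F e in ?F. \<forall>x\<in>X. n1 \<bullet> p e x > c1"
  proof -
    obtain i where i: "i \<in> A" using neA by blast
    show ?thesis using n1 by (intro near[OF _ i n1[OF i]] less_imp_le)
  qed
  ultimately have "\<forall>\<^sub>F e in ?F. e > 0 \<and> (\<forall>x\<in>X. e < F x) \<and>
      (\<forall>u\<in>A \<union> Y. \<forall>v\<in>A \<union> Y.
          strictly_supported (A \<union> Y) u v \<longrightarrow> strictly_supported (p e ` X \<union> A \<union> Y) u v) \<and>
      (\<forall>s\<in>X. \<forall>t\<in>X. strictly_supported (p e ` X \<union> A \<union> Y) (p e s) (p e t)) \<and>
      (\<forall>s\<in>X. \<forall>i\<in>A. \<exists>n c. n \<bullet> p e s = c \<and> n \<bullet> i = c \<and> (\<forall>x\<in>X - {s}. n \<bullet> p e x > c) \<and>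
          (\<forall>a\<in>A - {i}. n \<bullet> a > c) \<and> (\<forall>y\<in>Y. n \<bullet> y > c)) \<and>
      (\<forall>x\<in>X. \<forall>y\<in>Y. unsupported (p e ` X \<union> A \<union> Y) (p e x) y) \<and> (\<forall>x\<in>X. n1 \<bullet> p e x > c1)"
    using e0 eF by (intro eventually_conj)
  then obtain e where e: "e > 0" "\<forall>x\<in>X. e < F x"
      "\<forall>u\<in>A \<union> Y. \<forall>v\<in>A \<union> Y.
          strictly_supported (A \<union> Y) u v \<longrightarrow> strictly_supported (p e ` X \<union> A \<union> Y) u v"
      "\<forall>s\<in>X. \<forall>t\<in>X. strictly_supported (p e ` X \<union> A \<union> Y) (p e s) (p e t)"
      "\<forall>s\<in>X. \<forall>i\<in>A. \<exists>n c. n \<bullet> p e s = c \<and> n \<bullet> i = c \<and> (\<forall>x\<in>X - {s}. n \<bullet> p e x > c) \<and>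
          (\<forall>a\<in>A - {i}. n \<bullet> a > c) \<and> (\<forall>y\<in>Y. n \<bullet> y > c)"
      "\<forall>x\<in>X. \<forall>y\<in>Y. unsupported (p e ` X \<union> A \<union> Y) (p e x) y" "\<forall>x\<in>X. n1 \<bullet> p e x > c1"
    by (elim eventually_happens'[OF trivial_limit_at_right_real, THEN exE] conjE)
  have "inj_on (p e) X"
  proof (rule inj_onI, rule ccontr)
    fix s t assume st: "s \<in> X" "t \<in> X" "p e s = p e t" "s \<noteq> t"
    obtain i where "i \<in> A" using neA by blast
    then obtain n c where "n \<bullet> p e s = c" "\<forall>x\<in>X - {s}. n \<bullet> p e x > c" using e(5) st(1) by blast
    then show False using st by auto
  qed
  show ?thesis
  proof (intro exI[of _ "p e ` X"] conjI)
    show "finite (p e ` X)" using X(2) by simp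
    show "card (p e ` X) = m" using X(3) \<open>inj_on (p e) X\<close> by (simp add: card_image)
    show "\<forall>q\<in>p e ` X. n0 \<bullet> q < c0"
    proof clarify
      fix x assume x: "x \<in> X"
      have "(F x - e) * (n0 \<bullet> p e x - c0) = - (e * d)"
        using p[of e x n0 c0] e(2) x n0(1) by (simp add: d_def)
      then have "(F x - e) * ((- n0) \<bullet> p e x - (- c0)) = e * d" by (simp add: algebra_simps)
      then have "(F x - e) * ((- n0) \<bullet> p e x - (- c0)) > 0" using e(1) d by simp
      then have "(- n0) \<bullet> p e x > - c0" using e(2) x by (blast intro: posD)
      then show "n0 \<bullet> p e x < c0" by simp
    qed
    show "\<forall>q\<in>p e ` X. n1 \<bullet> q > c1" using e(7) by simp
    show "\<forall>u\<in>A \<union> Y. \<forall>v\<in>A \<union> Y. strictly_supported (A \<union> Y) u v \<longrightarrow> strictly_supported (p e ` X \<union> A \<union> Y) u v" using e(3) .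
    show "\<forall>q\<in>p e ` X. \<forall>y\<in>Y. unsupported (p e ` X \<union> A \<union> Y) q y" using e(6) by simp
    have "strictly_supported (p e ` X \<union> A \<union> Y) (p e x) a" if x: "x \<in> X" "a \<in> A" for x a
    proof -
      obtain n c where "n \<bullet> p e x = c" "n \<bullet> a = c" "\<forall>r\<in>X - {x}. n \<bullet> p e r > c"
        "\<forall>a\<in>A - {a}. n \<bullet> a > c" "\<forall>y\<in>Y. n \<bullet> y > c" using e(5) x by blast
      then show ?thesis
        unfolding strictly_supported_def by (intro exI[of _ n] exI[of _ c]) auto
    qed
    then show "\<forall>q\<in>p e ` X. \<forall>r\<in>p e ` X \<union> A. strictly_supported (p e ` X \<union> A \<union> Y) q r" using e(4) by blast
  qed
qed

section \<open>The staircase tube\<close>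

lemma inner_sum_Basis_scaled:
  fixes h :: "nat \<Rightarrow> 'a::euclidean_space"
  assumes h: "bij_betw h {..<d} Basis" and k: "k < d"
  shows "(\<Sum>i<d. c i *\<^sub>R h i) \<bullet> h k = c k"
proof -
  have "(\<Sum>i<d. c i *\<^sub>R h i) \<bullet> h k = (\<Sum>i<d. if i = k then c i else 0)"
    unfolding inner_sum_left
  proof (intro sum.cong refl)
    fix i assume i: "i \<in> {..<d}"
    have "h i \<in> Basis" "h k \<in> Basis" "h i = h k \<longleftrightarrow> i = k"
      using h i k by (auto simp: bij_betw_def inj_on_def)
    then show "c i *\<^sub>R h i \<bullet> h k = (if i = k then c i else 0)"
      by (simp add: inner_Basis)
  qed
  then show ?thesis using k by simp
qed

text \<open>One base is the standard basis, the other a perturbed double of it, so the tube is a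
  truncated cone with apex 0. The order of the \<open>w i\<close> decides which pairs are edges; the
  bound 1/(8 d) only provides slack in the estimates.\<close>

lemma tube_exists:
  fixes d :: nat
  assumes d: "DIM('a::euclidean_space) = d" "d \<ge> 3"
  obtains a b :: "nat \<Rightarrow> 'a::euclidean_space" and nA cA nB cB where
    "\<not> affine_dependent (a ` {..<d})" "\<not> affine_dependent (b ` {..<d})"
    "inj_on a {..<d}" "inj_on b {..<d}"
    "\<And>i. i < d \<Longrightarrow> nA \<bullet> a i = cA" "\<And>i. i < d \<Longrightarrow> nA \<bullet> b i > cA"
    "\<And>i. i < d \<Longrightarrow> nB \<bullet> b i = cB" "\<And>i. i < d \<Longrightarrow> nB \<bullet> a i > cB"
    "\<And>i j. i \<le> j \<Longrightarrow> j < d \<Longrightarrow> strictly_supported (a ` {..<d} \<union> b ` {..<d}) (a i) (b j)"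
    "\<And>i j. j < i \<Longrightarrow> i < d \<Longrightarrow> unsupported (a ` {..<d} \<union> b ` {..<d}) (a i) (b j)"
proof -
  obtain h :: "nat \<Rightarrow> 'a" where h: "bij_betw h {..<d} Basis"
    using d(1) by (metis card_lessThan finite_Basis finite_lessThan finite_same_card_bij)
  define w where "w i = real (i + 1) / (8 * (real d)^2)" for i
  have w0: "w i > 0" for i using d(2) by (simp add: w_def)
  have w1: "w i \<le> 1 / (8 * real d)" if "i < d" for i
  proof -
    have "w i \<le> real d / (8 * (real d)^2)" unfolding w_def using that by (intro divide_right_mono) auto
    also have "\<dots> = 1 / (8 * real d)" using d(2) by (simp add: power2_eq_square)
    finally show ?thesis .
  qed
  have wmono: "w i < w j" if "i < j" for i j
    unfolding w_def using that d(2) by (intro divide_strict_right_mono) auto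
  have wd: "real d * w i \<le> 1/8" if "i < d" for i
    using mult_left_mono[OF w1[OF that], of "real d"] d(2) by simp
  have w8: "w i \<le> 1/8" if "i < d" for i
    using w1[OF that] by (rule order_trans) (use d(2) in simp)
  define W where "W = (\<Sum>i<d. w i)"
  have W: "W \<le> 1/8"
  proof -
    have "W \<le> (\<Sum>i<d. 1 / (8 * real d))" unfolding W_def using w1 by (intro sum_mono) auto
    then show ?thesis using d(2) by simp
  qed
  \<comment> \<open>Projecting from 0, \<open>b j\<close> is pushed out of the prism by an amount increasing in \<open>j\<close>; this is what
    selects the diagonal \<open>a i\<close>, \<open>b j\<close> with \<open>i < j\<close> of each quadrilateral.\<close>
  define b where "b j = 2 *\<^sub>R (h j - w j *\<^sub>R One)" for j
  have hB: "h k \<in> Basis" if "k < d" for k using h that by (auto simp: bij_betw_def)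
  have One: "n \<bullet> One = (\<Sum>k<d. n \<bullet> h k)" for n :: 'a
    unfolding inner_sum_right using sum.reindex_bij_betw[OF h, of "\<lambda>x. n \<bullet> x"] by simp
  have nb: "n \<bullet> b j = 2 * (n \<bullet> h j - w j * (n \<bullet> One))" for n j
    by (simp add: b_def inner_diff_right)
  have fn: "(\<Sum>i<d. c i *\<^sub>R h i) \<bullet> h k = c k" if "k < d" for c k
    using inner_sum_Basis_scaled[OF h that] .
  have fnO: "(\<Sum>i<d. c i *\<^sub>R h i) \<bullet> One = (\<Sum>i<d. c i)" for c
    unfolding One using fn by (intro sum.cong) auto
  have eq0: "n = 0" if n: "\<And>k. k < d \<Longrightarrow> n \<bullet> h k = 0" for n :: 'a
  proof (rule euclidean_eqI)
    fix u :: 'a assume "u \<in> Basis"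
    then have "u \<in> h ` {..<d}" using h by (simp add: bij_betw_def)
    then obtain k where "k < d" "u = h k" by blast
    then show "n \<bullet> u = 0 \<bullet> u" using n by simp
  qed
  \<comment> \<open>G is to have inner product 1 with every \<open>b k\<close>. Writing sg for its
    inner product with \<open>One\<close>, this means that its coordinates are 1/2 + w k * sg;
    summing them determines sg.\<close>
  define sg where "sg = real d / (2 * (1 - W))"
  define G where "G = (\<Sum>k<d. (1/2 + w k * sg) *\<^sub>R h k)"
  have Gsum: "G \<bullet> One = sg"
  proof -
    have "G \<bullet> One = real d / 2 + W * sg"
      unfolding G_def fnO by (simp add: sum.distrib W_def sum_distrib_right)
    also have "real d / 2 = (1 - W) * sg" using W by (simp add: sg_def field_simps)
    finally show ?thesis by (simp add: algebra_simps)
  qed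
  have Gh: "G \<bullet> h k = 1/2 + w k * sg" if "k < d" for k
    unfolding G_def using fn[OF that] .
  have Gb: "G \<bullet> b k = 1" if "k < d" for k
    unfolding nb Gsum Gh[OF that] by simp
  have Gh1: "G \<bullet> h k < 1" if "k < d" for k
  proof -
    have "w k * sg = (real d * w k) / (2 * (1 - W))" by (simp add: sg_def)
    also have "\<dots> \<le> (1/8) / (2 * (1 - W))"
      using wd[OF that] W by (intro divide_right_mono) auto
    also have "\<dots> < 1/2" using W by (simp add: field_simps)
    finally show ?thesis using Gh[OF that] by simp
  qed
  have injh: "inj_on h {..<d}" using h by (simp add: bij_betw_def)
  have bh: "b j \<bullet> h k = (if j = k then 2 else 0) - 2 * w j" if "j < d" "k < d" for j k
  proof -
    have "h j \<bullet> h k = (if j = k then 1 else 0)"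
      using that hB injh by (auto simp: inner_Basis inj_on_def)
    then show ?thesis using hB[OF that(2)] by (simp add: b_def inner_diff_left)
  qed
  have injb: "inj_on b {..<d}"
  proof (rule inj_onI, rule ccontr)
    fix i j assume ij: "i \<in> {..<d}" "j \<in> {..<d}" "b i = b j" "i \<noteq> j"
    then have "2 - 2 * w i = - 2 * w j" using bh[of i i] bh[of j i] by simp
    moreover have "w i \<le> 1/8" using w8 ij by simp
    ultimately show False using w0[of j] by simp
  qed
  have indh: "\<not> affine_dependent (h ` {..<d})"
    using h independent_Basis affine_dependent_imp_dependent by (auto simp: bij_betw_def)
  have indb: "\<not> affine_dependent (b ` {..<d})"
  proof
    assume "affine_dependent (b ` {..<d})"
    then obtain U where U: "sum U (b ` {..<d}) = 0" "\<exists>v\<in>b ` {..<d}. U v \<noteq> 0"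
      "(\<Sum>v\<in>b ` {..<d}. U v *\<^sub>R v) = 0"
      using affine_dependent_explicit_finite[of "b ` {..<d}"] by auto
    define u where "u i = U (b i)" for i
    define m where "m = (\<Sum>i<d. u i * w i)"
    have sum: "(\<Sum>i<d. u i) = 0" "(\<Sum>i<d. u i *\<^sub>R b i) = 0"
      using U(1,3) by (simp_all add: sum.reindex[OF injb] u_def)
    \<comment> \<open>Pairing the vanishing combination with \<open>h k\<close> shows that all
      coefficients are equal; their sum is 0, so they vanish.\<close>
    have um: "u k = m" if k: "k < d" for k
    proof -
      have "0 = (\<Sum>i<d. u i *\<^sub>R b i) \<bullet> h k" using sum(2) by simp
      also have "\<dots> = (\<Sum>i<d. (if i = k then 2 * u i else 0) - 2 * (u i * w i))"
        unfolding inner_sum_left using k by (intro sum.cong) (simp_all add: bh right_diff_distrib)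
      also have "\<dots> = 2 * u k - 2 * m"
        unfolding sum_subtractf m_def sum_distrib_left using k by simp
      finally show ?thesis by simp
    qed
    then have "real d * m = 0" using sum(1) by simp
    then have "m = 0" using d(2) by simp
    then show False using U(2) um by (auto simp: u_def)
  qed
  show ?thesis
  proof (rule that[of h b One 1 "- G" "-1"])
    fix i assume i: "i < d"
    show "One \<bullet> h i = 1" using hB[OF i] by simp
    show "One \<bullet> b i > 1"
    proof -
      have "(One :: 'a) \<bullet> One = real d" using d(1) by (simp add: inner_sum_right)
      then have "One \<bullet> b i = 2 * (1 - w i * real d)" unfolding nb using hB[OF i] by simp
      then show ?thesis using wd[OF i] by (simp add: algebra_simps)
    qed
    show "- G \<bullet> b i = - 1" using Gb[OF i] by simp
    show "- G \<bullet> h i > - 1" using Gh1[OF i] by simp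
  next
    fix i j assume ij: "i \<le> j" "j < d"
    show "strictly_supported (h ` {..<d} \<union> b ` {..<d}) (h i) (b j)"
    proof -
      \<comment> \<open>The normal n will have n \<bullet> One = 1 and coordinates 2 v + ps k, with
        level 2 v. Then \<open>h k\<close> is above the level iff ps k > 0, and \<open>b k\<close>
        iff ps k > w k - v. Equality at \<open>h i\<close> and \<open>b j\<close> forces ps i = 0
        and ps j = w j - v. For i < j the points \<open>b i\<close> and \<open>h j\<close> are above
        iff w i < v < w j, hence the mean; for i = j the two equalities agree.\<close>
      define v where "v = (w i + w j) / 2"
      have v: "w i \<le> v" "v \<le> w j" "i < j \<Longrightarrow> w i < v" "i < j \<Longrightarrow> v < w j" "i = j \<Longrightarrow> v = w j"
        using wmono[of i j] ij by (auto simp: v_def le_less)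
      have v8: "real d * v \<le> 1/8" "v \<le> 1/8" "v > 0"
      proof -
        show "real d * v \<le> 1/8" using mult_left_mono[OF v(2), of "real d"] wd[OF ij(2)] by simp
        show "v > 0" using v(1) w0[of i] by simp
        have "1 * v \<le> real d * v" using d(2) \<open>v > 0\<close> by (intro mult_right_mono) auto
        then show "v \<le> 1/8" using \<open>real d * v \<le> 1/8\<close> by simp
      qed
      define I where "I = {i, j}"
      define q where "q = real (card ({..<d} - I))"
      have cardI: "card ({..<d} - I) > 0"
      proof -
        have "card I \<le> 2" unfolding I_def by (simp add: card_insert_if)
        moreover have "card ({..<d} - I) = d - card I" using ij by (subst card_Diff_subset) (auto simp: I_def)
        ultimately show ?thesis using d(2) by simp
      qed
      have q: "q > 0" "q \<le> real d" unfolding q_def using cardI card_mono[of "{..<d}" "{..<d} - I"] by auto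
      \<comment> \<open>The common value on the indices other than i and j, of which d \<ge> 3
        leaves at least one, is determined by n \<bullet> One = 1.\<close>
      define th where "th = (1 - 2 * real d * v - (w j - v)) / q"
      have th: "th > 1 / (8 * real d)"
      proof -
        have wj: "w j \<le> 1/8" using w8 ij by simp
        have "1/2 \<le> 1 - 2 * real d * v - (w j - v)"
          using v8 wj by (simp add: algebra_simps)
        then have "(1/2) / real d \<le> th"
          unfolding th_def using q d(2) by (intro frac_le) auto
        moreover have "1 / (8 * real d) < (1/2) / real d" using d(2) by (simp add: field_simps)
        ultimately show ?thesis by simp
      qed
      define ps where "ps k = (if k = i then 0 else if k = j then w j - v else th)" for k
      define n where "n = (\<Sum>k<d. (2 * v + ps k) *\<^sub>R h k)"
      have "(\<Sum>k<d. ps k) = (\<Sum>k\<in>I. ps k) + (\<Sum>k\<in>{..<d} - I. ps k)"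
        using ij by (subst sum.subset_diff[of I "{..<d}"]) (auto simp: I_def)
      also have "(\<Sum>k\<in>{..<d} - I. ps k) = q * th"
        unfolding q_def by (simp add: ps_def I_def)
      also have "q * th = 1 - 2 * real d * v - (w j - v)" using q by (simp add: th_def)
      also have "(\<Sum>k\<in>I. ps k) = w j - v" using v(5) by (cases "i = j") (simp_all add: I_def ps_def)
      finally have "n \<bullet> One = 1" unfolding n_def fnO by (simp add: sum.distrib)
      then have nb': "n \<bullet> b k = 2 * (2 * v + ps k - w k)" if "k < d" for k
        unfolding nb using fn[OF that] by (simp add: n_def)
      have nh: "n \<bullet> h k = 2 * v + ps k" if "k < d" for k using fn[OF that] by (simp add: n_def)
      have id: "i < d" using ij by simp
      show ?thesis
        unfolding strictly_supported_def
      proof (intro exI[of _ n] exI[of _ "2 * v"] conjI ballI)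
        show "n \<bullet> h i = 2 * v" using nh[OF id] by (simp add: ps_def)
        show "n \<bullet> b j = 2 * v" using nb'[OF ij(2)] v(5) by (auto simp: ps_def)
      next
        fix y assume y: "y \<in> h ` {..<d} \<union> b ` {..<d} - {h i, b j}"
        have thp: "th > 0" using th by (smt (verit) divide_nonneg_nonneg of_nat_0_le_iff)
        show "2 * v < n \<bullet> y"
        proof (cases "y \<in> h ` {..<d}")
          case True
          then obtain k where k: "k < d" "y = h k" "k \<noteq> i" using y by auto
          then show ?thesis using nh[OF k(1)] v(4) thp ij(1) by (auto simp: ps_def)
        next
          case False
          then obtain k where k: "k < d" "y = b k" "k \<noteq> j" using y by auto
          have "w k \<le> 1 / (8 * real d)" using w1[OF k(1)] .
          then show ?thesis using nb'[OF k(1)] v(3) th k ij(1) v8(3) by (auto simp: ps_def k(2))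
        qed
      qed
    qed
  next
    fix i j assume ij: "j < i" "i < d"
    show "unsupported (h ` {..<d} \<union> b ` {..<d}) (h i) (b j)"
      unfolding unsupported_def
    proof (intro allI impI)
      fix n c assume n: "\<forall>y\<in>h ` {..<d} \<union> b ` {..<d}. c \<le> n \<bullet> y" "n \<bullet> h i = c" "n \<bullet> b j = c"
      \<comment> \<open>The bound at \<open>b i\<close> gives 2 w i s \<le> c and equality at
        \<open>b j\<close> gives c \<le> 2 w j s. As w j < w i, neither s nor c is positive.
        Combined with d c \<le> s and the smallness of \<open>w i\<close>, this leaves c = s = 0,
        and all coordinates of n vanish.\<close>
      define s where "s = n \<bullet> (One :: 'a)"
      have nh: "c \<le> n \<bullet> h k" if "k < d" for k using n(1) that by auto
      have jd: "j < d" using ij by simp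
      have "real d * c = (\<Sum>k<d. c)" by simp
      also have "\<dots> \<le> s" unfolding s_def One using nh by (intro sum_mono) auto
      finally have s: "real d * c \<le> s" .
      have "c \<le> n \<bullet> b i" using n(1) ij by auto
      then have 1: "2 * (w i * s) \<le> c" using n(2) unfolding nb s_def by simp
      have "c = 2 * (n \<bullet> h j - w j * s)" using n(3) unfolding nb s_def by simp
      then have 2: "c \<le> 2 * (w j * s)" using nh[OF jd] by (simp add: algebra_simps)
      have "s \<le> 0"
      proof (rule ccontr)
        assume "\<not> s \<le> 0"
        then have "w j * s < w i * s" using wmono[OF ij(1)] by simp
        then show False using 1 2 by linarith
      qed
      then have "w j * s \<le> 0" using w0[of j] by (simp add: mult_nonneg_nonpos)
      then have c0: "c \<le> 0" using 2 by linarith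
      have "w i * (real d * c) \<le> w i * s" using s w0[of i] by (intro mult_left_mono) auto
      then have "2 * (real d * w i) * c \<le> c" using 1 by (simp add: algebra_simps)
      moreover have "2 * (real d * w i) * c \<ge> (1/4) * c"
        using wd[OF ij(2)] c0 by (intro mult_right_mono_neg) auto
      ultimately have "c = 0" using c0 by simp
      then have "s = 0" using s \<open>s \<le> 0\<close> by simp
      then have "(\<Sum>k<d. n \<bullet> h k) = 0" unfolding s_def One .
      then have "\<forall>k<d. n \<bullet> h k = 0"
        using nh \<open>c = 0\<close> by (subst (asm) sum_nonneg_eq_0_iff) auto
      then show "n = 0" using eq0 by blast
    qed
  qed (use indh indb injh injb in auto)
qed

section \<open>Cuts of a graph with two clusters\<close>

text \<open>Each k in K other than v has its own cut edge, to whichever of u and v lies on the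
  opposite side. Leaving out v may cost one element, hence the strict bound on
  \<open>card K\<close>.\<close>

lemma cut_splitting_cluster:
  assumes fin: "finite (edges_of G)"
    and U: "U \<subseteq> verts_of G" "K \<subseteq> U" "finite K" "card K > N"
    and adj: "\<And>k u. k \<in> K \<Longrightarrow> u \<in> U \<Longrightarrow> k \<noteq> u \<Longrightarrow> {k, u} \<in> edges_of G"
    and X: "u \<in> U \<inter> X" "v \<in> U - X"
  shows "N \<le> card (edges_between G X (verts_of G - X))"
proof -
  let ?phi = "\<lambda>k. if k \<in> X then {k, v} else {k, u}"
  have "inj_on ?phi (K - {v})"
    using X by (intro inj_onI) (auto simp: doubleton_eq_iff split: if_splits)
  moreover have "?phi ` (K - {v}) \<subseteq> edges_between G X (verts_of G - X)"
  proof
    fix e assume "e \<in> ?phi ` (K - {v})"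
    then obtain k where k: "k \<in> K" "k \<noteq> v" "e = ?phi k" by blast
    have kV: "k \<in> verts_of G" "v \<in> verts_of G" using k U X by auto
    show "e \<in> edges_between G X (verts_of G - X)"
    proof (cases "k \<in> X")
      case True
      then have "e = {k, v}" using k by simp
      then show ?thesis unfolding edges_between_def using True kV X adj[of k v] k by blast
    next
      case False
      then have "e = {u, k}" using k by (simp add: insert_commute)
      then show ?thesis
        unfolding edges_between_def using False kV X adj[of k u] k by (auto simp: insert_commute)
    qed
  qed
  moreover have "finite (edges_between G X (verts_of G - X))"
    using fin by (simp add: edges_between_def)
  ultimately have "card (K - {v}) \<le> card (edges_between G X (verts_of G - X))"
    by (rule card_inj_on_le)
  then show ?thesis using U(3,4) by (simp add: card_Diff_singleton_if split: if_splits)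
qed

lemma card_incident_edges_cluster:
  assumes fin: "finite (edges_of G)"
    and U: "K \<subseteq> U" "finite K" "card K > N" "v \<in> U"
    and adj: "\<And>k u. k \<in> K \<Longrightarrow> u \<in> U \<Longrightarrow> k \<noteq> u \<Longrightarrow> {k, u} \<in> edges_of G"
  shows "N \<le> card (incident_edges G v)"
proof -
  have "inj_on (\<lambda>k. {k, v}) (K - {v})"
    by (intro inj_onI) (auto simp: doubleton_eq_iff)
  moreover have "(\<lambda>k. {k, v}) ` (K - {v}) \<subseteq> incident_edges G v"
    unfolding incident_edges_def using adj U by blast
  moreover have "finite (incident_edges G v)"
    using fin by (simp add: incident_edges_def)
  ultimately have "card (K - {v}) \<le> card (incident_edges G v)"
    by (rule card_inj_on_le)
  then show ?thesis using U(2,3) by (simp add: card_Diff_singleton_if split: if_splits)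
qed

text \<open>The disjoint edges e1 and e2 are there for nontriviality: no vertex lies on all edges of
  C.\<close>

lemma two_clusters:
  assumes V: "verts_of G = U \<union> W" "U \<inter> W = {}" "U \<noteq> {}" "W \<noteq> {}" "finite (verts_of G)"
    and fin: "finite (edges_of G)"
    and K: "K \<subseteq> U" "card K > N" "L \<subseteq> W" "card L > N"
    and adjU: "\<And>k u. k \<in> K \<Longrightarrow> u \<in> U \<Longrightarrow> k \<noteq> u \<Longrightarrow> {k, u} \<in> edges_of G"
    and adjW: "\<And>k u. k \<in> L \<Longrightarrow> u \<in> W \<Longrightarrow> k \<noteq> u \<Longrightarrow> {k, u} \<in> edges_of G"
    and C: "C = edges_between G U W" "card C = N"
    and e: "e1 \<in> C" "e2 \<in> C" "e1 \<inter> e2 = {}"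
  shows "N \<le> min_degree G" "minimum_edge_cut G C" "\<not> trivial_edge_cut G C"
proof -
  have finKL: "finite K" "finite L" using V K by (metis finite_Un finite_subset)+
  have "N \<le> card (incident_edges G v)" if "v \<in> verts_of G" for v
    using that V(1) card_incident_edges_cluster[OF fin K(1) finKL(1) K(2) _ adjU]
      card_incident_edges_cluster[OF fin K(3) finKL(2) K(4) _ adjW] by auto
  then show "N \<le> min_degree G"
    unfolding min_degree_def using V by (intro Min.boundedI) auto
  have UW: "verts_of G - U = W" "verts_of G - W = U" using V by auto
  have cut: "edge_cut G C"
    unfolding edge_cut_def
  proof (intro exI conjI)
    show "U \<noteq> {}" "U \<subset> verts_of G" using V by blast+
    show "C = edges_between G U (verts_of G - U)" unfolding UW by (rule C(1))
  qed
  have "N \<le> card D" if "edge_cut G D" for D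
  proof -
    obtain X where X: "X \<noteq> {}" "X \<subset> verts_of G" "D = edges_between G X (verts_of G - X)"
      using \<open>edge_cut G D\<close> unfolding edge_cut_def by blast
    show ?thesis
    proof (cases "(U \<inter> X \<noteq> {} \<and> U - X \<noteq> {}) \<or> (W \<inter> X \<noteq> {} \<and> W - X \<noteq> {})")
      case True
      then show ?thesis
      proof (elim disjE conjE)
        assume "U \<inter> X \<noteq> {}" "U - X \<noteq> {}"
        then obtain u v where "u \<in> U \<inter> X" "v \<in> U - X" by blast
        then show ?thesis unfolding X(3)
          using V(1) by (intro cut_splitting_cluster[OF fin _ K(1) finKL(1) K(2) adjU]) auto
      next
        assume "W \<inter> X \<noteq> {}" "W - X \<noteq> {}"
        then obtain u v where "u \<in> W \<inter> X" "v \<in> W - X" by blast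
        then show ?thesis unfolding X(3)
          using V(1) by (intro cut_splitting_cluster[OF fin _ K(3) finKL(2) K(4) adjW]) auto
      qed
    next
      case False
      then have "X = U \<or> X = W" using X(1,2) V by blast
      then have "D = C"
      proof
        assume "X = W"
        have "D = edges_between G W U" unfolding X(3) \<open>X = W\<close> UW ..
        also have "\<dots> = C"
          unfolding C(1) edges_between_def by (intro Collect_cong) (metis insert_commute)
        finally show "D = C" .
      qed (use X C UW in simp)
      then show ?thesis using C by simp
    qed
  qed
  then show "minimum_edge_cut G C" unfolding minimum_edge_cut_def using cut C(2) by simp
  show "\<not> trivial_edge_cut G C"
    unfolding trivial_edge_cut_def incident_edges_def using e by blast
qed

section \<open>Basic facts on the graph of a polytope\<close>

lemma edge_in_polytope_graph:
  "{u, v} \<in> edges_of (polytope_graph P) \<longleftrightarrow> closed_segment u v edge_of P"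
proof
  assume "{u, v} \<in> edges_of (polytope_graph P)"
  then obtain x y where "{u, v} = {x, y}" "closed_segment x y edge_of P"
    by (auto simp: polytope_graph_def)
  then show "closed_segment u v edge_of P"
    by (auto simp: doubleton_eq_iff closed_segment_commute)
qed (auto simp: polytope_graph_def)

lemma edge_endpoints_extreme:
  assumes "closed_segment u v edge_of P"
  shows "u extreme_point_of P" "v extreme_point_of P"
  using assms extreme_point_of_face[of "closed_segment u v" P]
  by (auto simp: edge_of_def extreme_point_of_segment)

lemma finite_polytope_graph:
  assumes "finite S"
  shows "finite (edges_of (polytope_graph (convex hull S)))"
proof (rule finite_subset)
  show "edges_of (polytope_graph (convex hull S)) \<subseteq> Pow S"
  proof
    fix e assume "e \<in> edges_of (polytope_graph (convex hull S))"
    then obtain u v where uv: "e = {u, v}" "closed_segment u v edge_of convex hull S"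
      by (auto simp: polytope_graph_def)
    have "u \<in> S" "v \<in> S"
      using edge_endpoints_extreme[OF uv(2)] by (simp_all add: extreme_point_of_convex_hull)
    then show "e \<in> Pow S" using uv(1) by simp
  qed
qed (use assms in simp)

lemma card_triangle: "card (SIGMA j:{..<d}. {..j::nat}) = d * (d + 1) div 2"
proof -
  have "(\<Sum>j<d. Suc j) = d * (d + 1) div 2" by (induction d) auto
  then show ?thesis by simp
qed

section \<open>The polytope\<close>

theorem proposition11:
  fixes d :: nat
  assumes "d \<ge> 4" and "CARD('n::finite) = d"
  shows "\<exists>P :: (real ^ 'n) set.
           simplicial_polytope P \<and> aff_dim P = int d \<and>
           real (min_degree (polytope_graph P)) \<ge> (real d ^ 2 + real d) / 2 \<and>
           (\<exists>C. minimum_edge_cut (polytope_graph P) C \<and>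
                \<not> trivial_edge_cut (polytope_graph P) C \<and>
                real (card C) = (real d ^ 2 + real d) / 2)"
proof -
  define N where "N = d * (d + 1) div 2"
  have N: "real N = (real d ^ 2 + real d) / 2"
  proof -
    have "even (d * (d + 1))" by simp
    then have "2 * N = d * (d + 1)" unfolding N_def by simp
    then have "2 * real N = real d * (real d + 1)" by (metis of_nat_1 of_nat_add of_nat_mult of_nat_numeral)
    then show ?thesis by (simp add: power2_eq_square algebra_simps)
  qed
  have dim: "DIM(real ^ 'n) = d" using assms(2) by simp
  have d3: "d \<ge> 3" using assms(1) by simp
  have Nd: "N \<ge> d"
  proof -
    have "d * 2 \<le> d * (d + 1)" using assms(1) by (intro mult_left_mono) auto
    then show ?thesis unfolding N_def by linarith
  qed
  obtain a b :: "nat \<Rightarrow> real ^ 'n" and nA cA nB cB where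
    ind: "\<not> affine_dependent (a ` {..<d})" "\<not> affine_dependent (b ` {..<d})"
      and inj: "inj_on a {..<d}" "inj_on b {..<d}"
      and nA: "\<And>i. i < d \<Longrightarrow> nA \<bullet> a i = cA" "\<And>i. i < d \<Longrightarrow> nA \<bullet> b i > cA"
      and nB: "\<And>i. i < d \<Longrightarrow> nB \<bullet> b i = cB" "\<And>i. i < d \<Longrightarrow> nB \<bullet> a i > cB"
      and tube: "\<And>i j. i \<le> j \<Longrightarrow> j < d \<Longrightarrow> strictly_supported (a ` {..<d} \<union> b ` {..<d}) (a i) (b j)"
        "\<And>i j. j < i \<Longrightarrow> i < d \<Longrightarrow> unsupported (a ` {..<d} \<union> b ` {..<d}) (a i) (b j)"
    using tube_exists[OF dim d3] by blast
  define A where "A = a ` {..<d}"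
  define B where "B = b ` {..<d}"
  have cards: "card A = DIM(real ^ 'n)" "card B = DIM(real ^ 'n)" "DIM(real ^ 'n) \<ge> 4"
    using inj dim assms(1) by (simp_all add: A_def B_def card_image)
  have fin: "finite A" "finite B" by (simp_all add: A_def B_def)
  have ne: "A \<noteq> {}" "B \<noteq> {}" using d3 by (auto simp: A_def B_def lessThan_empty_iff)
  have nA': "\<And>x. x \<in> A \<Longrightarrow> nA \<bullet> x = cA" "\<And>x. x \<in> B \<Longrightarrow> nA \<bullet> x > cA" and
    nB': "\<And>x. x \<in> B \<Longrightarrow> nB \<bullet> x = cB" "\<And>x. x \<in> A \<Longrightarrow> nB \<bullet> x > cB"
    using nA nB by (auto simp: A_def B_def)
  \<comment> \<open>The first cap sits on A. With nB as the second functional, K stays on the same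
    side of the hyperplane of B as A.\<close>
  have "\<exists>K. finite K \<and> card K = N + 1 \<and> (\<forall>p\<in>K. nA \<bullet> p < cA) \<and> (\<forall>p\<in>K. nB \<bullet> p > cB) \<and>
    (\<forall>u\<in>A \<union> B. \<forall>v\<in>A \<union> B. strictly_supported (A \<union> B) u v \<longrightarrow> strictly_supported (K \<union> A \<union> B) u v) \<and>
    (\<forall>p\<in>K. \<forall>q\<in>K \<union> A. strictly_supported (K \<union> A \<union> B) p q) \<and>
    (\<forall>p\<in>K. \<forall>y\<in>B. unsupported (K \<union> A \<union> B) p y)"
    by (intro cap_glue ind[folded A_def] cards fin ne nA' nB')
  then obtain K where K: "finite K" "card K = N + 1" "\<forall>p\<in>K. nB \<bullet> p > cB"
    "\<forall>u\<in>A \<union> B. \<forall>v\<in>A \<union> B. strictly_supported (A \<union> B) u v \<longrightarrow> strictly_supported (K \<union> A \<union> B) u v"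
    "\<forall>p\<in>K. \<forall>q\<in>K \<union> A. strictly_supported (K \<union> A \<union> B) p q"
    "\<forall>p\<in>K. \<forall>y\<in>B. unsupported (K \<union> A \<union> B) p y"
    by (elim exE conjE)
  define U where "U = K \<union> A"
  have U: "finite U" "U \<noteq> {}" "\<And>y. y \<in> U \<Longrightarrow> nB \<bullet> y > cB"
    using K fin ne nB'(2) by (auto simp: U_def)
  have swap: "K \<union> A \<union> B = B \<union> U" by (auto simp: U_def)
  \<comment> \<open>The second cap sits on B and treats everything on the other side as Y. Its side
    condition is filled with the trivial inequality \<open>0 \<bullet> p > - 1\<close>.\<close>
  have "\<exists>L. finite L \<and> card L = N + 1 \<and> (\<forall>p\<in>L. nB \<bullet> p < cB) \<and> (\<forall>p\<in>L. 0 \<bullet> p > - 1) \<and>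
    (\<forall>u\<in>B \<union> U. \<forall>v\<in>B \<union> U. strictly_supported (B \<union> U) u v \<longrightarrow> strictly_supported (L \<union> B \<union> U) u v) \<and>
    (\<forall>p\<in>L. \<forall>q\<in>L \<union> B. strictly_supported (L \<union> B \<union> U) p q) \<and>
    (\<forall>p\<in>L. \<forall>y\<in>U. unsupported (L \<union> B \<union> U) p y)"
    by (intro cap_glue ind[folded B_def] cards U nB') simp_all
  then obtain L where L: "finite L" "card L = N + 1" "\<forall>p\<in>L. nB \<bullet> p < cB"
    "\<forall>u\<in>B \<union> U. \<forall>v\<in>B \<union> U. strictly_supported (B \<union> U) u v \<longrightarrow> strictly_supported (L \<union> B \<union> U) u v"
    "\<forall>p\<in>L. \<forall>q\<in>L \<union> B. strictly_supported (L \<union> B \<union> U) p q"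
    "\<forall>p\<in>L. \<forall>y\<in>U. unsupported (L \<union> B \<union> U) p y"
    by (elim exE conjE)
  define W where "W = L \<union> B"
  define S where "S = L \<union> B \<union> U"
  have S: "S = U \<union> W" "finite S" using L(1) fin U(1) by (auto simp: S_def W_def)
  have disj: "U \<inter> W = {}"
  proof -
    have "nB \<bullet> y \<le> cB" if "y \<in> W" for y
      using that L(3) nB'(1) by (auto simp: W_def less_imp_le)
    then show ?thesis using U(3) by (meson disjoint_iff not_less)
  qed
  have suppU: "strictly_supported S k u" if "k \<in> K" "u \<in> U" for k u
  proof -
    have "strictly_supported (B \<union> U) k u" using K(5) that unfolding swap U_def by blast
    then show ?thesis using L(4) that unfolding S_def U_def by blast
  qed
  have suppW: "strictly_supported S k u" if "k \<in> L" "u \<in> W" for k u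
    using that L(5) unfolding S_def W_def by blast
  have supp_ab: "strictly_supported S (a i) (b j)" if "i \<le> j" "j < d" for i j
  proof -
    have ab: "a i \<in> A" "b j \<in> B" using that by (auto simp: A_def B_def)
    have "strictly_supported (A \<union> B) (a i) (b j)" using tube(1)[OF that] by (simp add: A_def B_def)
    then have "strictly_supported (B \<union> U) (a i) (b j)" using K(4) ab unfolding swap by blast
    then show ?thesis using L(4) ab unfolding S_def U_def by blast
  qed
  \<comment> \<open>Pairs with a point of a cluster are settled by the caps, pairs of base vertices
    by the tube. What held before a later cluster was added persists by monotonicity.\<close>
  have unsupported_UW: "unsupported S u v" if "u \<in> U" "v \<in> W" "\<not> (\<exists>i j. i \<le> j \<and> j < d \<and> u = a i \<and> v = b j)" for u v
  proof -
    have "u \<in> K \<union> A" "v \<in> L \<union> B" using that by (auto simp: U_def W_def)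
    then consider "v \<in> L" | "v \<in> B" "u \<in> K" | "v \<in> B" "u \<in> A" by blast
    then show ?thesis
    proof cases
      case 1
      then show ?thesis using L(6) that(1) unfolding S_def unsupported_commute[of _ u v] by blast
    next
      case 2
      then have "unsupported (K \<union> A \<union> B) u v" using K(6) by blast
      then show ?thesis by (rule unsupported_mono) (auto simp: S_def U_def)
    next
      case 3
      then obtain i j where ij: "i < d" "j < d" "u = a i" "v = b j" by (auto simp: A_def B_def)
      then have "\<not> i \<le> j" using that(3) by blast
      then have "j < i" by simp
      then have "unsupported (A \<union> B) u v"
        using tube(2) ij by (simp add: A_def B_def)
      then show ?thesis by (rule unsupported_mono) (auto simp: S_def U_def)
    qed
  qed
  have "card S \<ge> N + 1" using card_mono[of S K] K(2) S(2) by (auto simp: S_def U_def)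
  then have cardS: "card S > DIM(real ^ 'n)" using Nd dim by simp
  have dim2: "DIM(real ^ 'n) \<ge> 2" using cards(3) by simp
  obtain f :: "real ^ 'n \<Rightarrow> real ^ 'n" where f: "inj_on f S" "simplicial_polytope (convex hull (f ` S))"
    "aff_dim (convex hull (f ` S)) = int DIM(real ^ 'n)"
    "\<And>u v. u \<in> S \<Longrightarrow> v \<in> S \<Longrightarrow> u \<noteq> v \<Longrightarrow> strictly_supported S u v \<Longrightarrow>
        closed_segment (f u) (f v) edge_of convex hull (f ` S)"
    "\<And>u v. u \<in> S \<Longrightarrow> v \<in> S \<Longrightarrow> unsupported S u v \<Longrightarrow>
        \<not> closed_segment (f u) (f v) edge_of convex hull (f ` S)"
    using simplicial_realization[OF S(2) cardS dim2] by blast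
  define P where "P = convex hull (f ` S)"
  define G where "G = polytope_graph P"
  have edge: "{x, y} \<in> edges_of G \<longleftrightarrow> closed_segment x y edge_of P" for x y
    unfolding G_def by (rule edge_in_polytope_graph)
  have adjU: "{f k, f u} \<in> edges_of G" if "k \<in> K" "u \<in> U" "k \<noteq> u" for k u
    unfolding edge P_def using that suppU S(1) by (intro f(4)) (auto simp: U_def)
  have adjW: "{f k, f u} \<in> edges_of G" if "k \<in> L" "u \<in> W" "k \<noteq> u" for k u
    unfolding edge P_def using that suppW S(1) by (intro f(4)) (auto simp: W_def)
  have another: "\<exists>k\<in>M. k \<noteq> u" if "card M = N + 1" for M and u :: "real ^ 'n"
  proof (rule ccontr)
    assume "\<not> ?thesis"
    then have "card M \<le> card {u}" by (intro card_mono) auto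
    then show False using that Nd assms(1) by simp
  qed
  \<comment> \<open>Ends of edges are extreme, so a point is a vertex once the cluster on its side
    contains another point, to which it is adjacent.\<close>
  have verts: "verts_of G = f ` U \<union> f ` W"
  proof -
    have "v extreme_point_of P" if v: "v \<in> f ` U \<union> f ` W" for v
    proof -
      obtain k where "{k, v} \<in> edges_of G"
        using v adjU adjW another[OF K(2)] another[OF L(2)] by blast
      then show ?thesis unfolding edge using edge_endpoints_extreme by blast
    qed
    moreover have "v \<in> f ` S" if "v extreme_point_of P" for v
      using that extreme_point_of_convex_hull unfolding P_def by blast
    ultimately have "{v. v extreme_point_of P} = f ` U \<union> f ` W" unfolding S(1) image_Un by blast
    then show ?thesis by (simp add: G_def polytope_graph_def)
  qed
  define c where "c = (\<lambda>(j, i). {f (a i), f (b j)})"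
  \<comment> \<open>The larger index comes first, so that the staircase is the \<open>SIGMA\<close>
    set counted by \<open>card_triangle\<close>.\<close>
  define T where "T = (SIGMA j:{..<d}. {..j})"
  have ab: "a i \<in> U" "b j \<in> W" "a i \<in> S" "b j \<in> S" if "(j, i) \<in> T" for i j
    using that S(1) by (auto simp: T_def U_def W_def A_def B_def)
  have fdisj: "f u \<noteq> f v" if "u \<in> U" "v \<in> W" for u v
    using f(1) that disj S(1) by (metis Un_iff disjoint_iff inj_onD)
  have injc: "inj_on c T"
  proof (rule inj_onI, clarify)
    fix j i j' i' assume *: "(j, i) \<in> T" "(j', i') \<in> T" "c (j, i) = c (j', i')"
    then have fab: "f (a i) = f (a i')" "f (b j) = f (b j')"
      using ab fdisj unfolding c_def by (auto simp: doubleton_eq_iff)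
    have "a i = a i'"
      by (rule inj_onD[OF f(1) fab(1) ab(3)[OF *(1)] ab(3)[OF *(2)]])
    moreover have "b j = b j'"
      by (rule inj_onD[OF f(1) fab(2) ab(4)[OF *(1)] ab(4)[OF *(2)]])
    ultimately show "j = j' \<and> i = i'" using inj * unfolding inj_on_def T_def by auto
  qed
  define C where "C = edges_between G (f ` U) (f ` W)"
  have C: "C = c ` T"
  proof
    show "C \<subseteq> c ` T"
    proof
      fix e assume "e \<in> C"
      then obtain u v where uv: "u \<in> U" "v \<in> W" "e = {f u, f v}" "e \<in> edges_of G"
        by (auto simp: C_def edges_between_def)
      then have "\<not> unsupported S u v" using f(5)[of u v] S(1) unfolding uv(3) edge P_def by blast
      then obtain i j where "i \<le> j" "j < d" "u = a i" "v = b j" using unsupported_UW uv by blast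
      then have "(j, i) \<in> T" "e = c (j, i)" using uv by (auto simp: T_def c_def)
      then show "e \<in> c ` T" by blast
    qed
    show "c ` T \<subseteq> C"
    proof clarify
      fix j i assume ji: "(j, i) \<in> T"
      then have "a i \<noteq> b j" using ab disj by (metis disjoint_iff)
      then have "closed_segment (f (a i)) (f (b j)) edge_of P"
        unfolding P_def using ji ab supp_ab by (intro f(4)) (auto simp: T_def)
      then show "c (j, i) \<in> C"
        using ab[OF ji] unfolding edge[symmetric] C_def edges_between_def c_def by auto
    qed
  qed
  have cardC: "card C = N"
    unfolding C card_image[OF injc] unfolding T_def N_def by (rule card_triangle)
  \<comment> \<open>The vertical edges at 0 and 1 are the two disjoint edges of the cut.\<close>
  have T01: "(0, 0) \<in> T" "(1, 1) \<in> T" using d3 by (auto simp: T_def)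
  then have e12: "c (0, 0) \<in> C" "c (1, 1) \<in> C" unfolding C by blast+
  have "a 0 \<noteq> a 1" "b 0 \<noteq> b 1"
    using inj_on_eq_iff[OF inj(1), of 0 1] inj_on_eq_iff[OF inj(2), of 0 1] d3 by simp_all
  then have "f (a 0) \<noteq> f (a 1)" "f (b 0) \<noteq> f (b 1)"
    using inj_on_eq_iff[OF f(1) ab(3)[OF T01(1)] ab(3)[OF T01(2)]]
      inj_on_eq_iff[OF f(1) ab(4)[OF T01(1)] ab(4)[OF T01(2)]] by simp_all
  moreover have "f (a 0) \<noteq> f (b 1)" "f (a 1) \<noteq> f (b 0)"
    using fdisj ab(1,2) T01 by blast+
  ultimately have e3: "c (0, 0) \<inter> c (1, 1) = {}" by (auto simp: c_def)
  have finG: "finite (verts_of G)" "finite (edges_of G)"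
  proof -
    show "finite (verts_of G)" unfolding verts using S by simp
    show "finite (edges_of G)" unfolding G_def P_def using S(2) by (intro finite_polytope_graph) simp
  qed
  have cardf: "card (f ` K) > N" "card (f ` L) > N"
  proof -
    have "inj_on f K" "inj_on f L"
      by (rule inj_on_subset[OF f(1)], auto simp: S_def U_def)+
    then show "card (f ` K) > N" "card (f ` L) > N"
      using K(2) L(2) by (simp_all add: card_image)
  qed
  have disjf: "f ` U \<inter> f ` W = {}" using fdisj by auto
  have sub: "f ` K \<subseteq> f ` U" "f ` L \<subseteq> f ` W" by (auto simp: U_def W_def)
  have ne': "f ` U \<noteq> {}" "f ` W \<noteq> {}" using U(2) ne by (auto simp: W_def)
  have adjU': "{k, u} \<in> edges_of G" if "k \<in> f ` K" "u \<in> f ` U" "k \<noteq> u" for k u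
    using that adjU by blast
  have adjW': "{k, u} \<in> edges_of G" if "k \<in> f ` L" "u \<in> f ` W" "k \<noteq> u" for k u
    using that adjW by blast
  note G = two_clusters[OF verts disjf ne' finG sub(1) cardf(1) sub(2) cardf(2) adjU' adjW'
      C_def cardC e12 e3]
  show ?thesis
  proof (intro exI[of _ P] conjI exI[of _ C])
    show "simplicial_polytope P" "aff_dim P = int d" using f(2,3) dim by (simp_all add: P_def)
    show "real (min_degree (polytope_graph P)) \<ge> (real d ^ 2 + real d) / 2"
      using G(1) unfolding N[symmetric] by (simp add: G_def)
    show "minimum_edge_cut (polytope_graph P) C" "\<not> trivial_edge_cut (polytope_graph P) C"
      using G(2,3) by (simp_all add: G_def)
    show "real (card C) = (real d ^ 2 + real d) / 2" unfolding cardC by (rule N)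
  qed
qed

end
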